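(* Consider the symmetrical Locks, Bombs and Testing model with $n$ sites, a fixed number $k$ of locks ($1\le k<n$), $m\ge 1$ bombs, test sensitivity $a$ and specificity $b$ with $0<a,b<1$ and $a+b>1$, explosion probability $p\in(0,1]$, $q=1-p$ and $p(u)=1-q^u$, as described in the context. Let the signal $s$ be given and let $N=N(s)=x$, $0\le x\le n$, be its total number of minuses. (a) If $x=0$ or $x=n$, then the optimal strategy is to distribute all bombs among the sites UAP (uniformly as possible), and, writing $m=n\,i+e$ with $i\in\{0,1,\dots\}$ and $0\le e<n$, the value function is $$v(0,m)=v(n,m)=\frac{n-k}{n}\bigl[e\,p(i+1)+(n-e)\,p(i)\bigr].$$ (b) If $0<x<n$, then the optimal strategy is to distribute all bombs between the minus and the plus sites $d(x)$-UAP, where $$d(x)=\min\{i\ge 1:\ r(x)\,q^{i}<1\}.$$ If $(i,e,j,e')$ is the tuple (uniquely) defined by $m$, $x$ and the $d(x)$-UAP strategy, so that $m=m^-+m^+$ with $m^-=i\,x+e$ and $m^+=j\,(n-x)+e'$, then $$v(x,m)=p^{+}(x)\Bigl[r(x)\bigl(e\,p(i+1)+(x-e)\,p(i)\bigr)+e'\,p(j+1)+(n-x-e')\,p(j)\Bigr].$$ (c) The value function $v(m)$, $m=1,2,\dots$, is given by $$v(m)=\sum_{x=0}^{n}P(N=x)\,v(x,m).$$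
   Context: **Model.** There are $n$ sites, all of value $1$. First, $k$ locks ($k$ fixed) are placed in $k$ distinct sites, all $\binom nk$ sets of locked sites being equally likely. Let $T_i=1$ if site $i$ has a lock and $T_i=0$ otherwise. Second, every site is tested, giving a signal $s=(s_1,\dots,s_n)\in\{0,1\}^n$, a value of the random vector $(S_1,\dots,S_n)$. Given the lock positions, the $S_i$ are independent, $S_i$ depends only on $T_i$, and $P(S_i=1\mid T_i=1)=a$ (sensitivity), $P(S_i=0\mid T_i=0)=b$ (specificity). The result $S_i=0$ is called a minus and $S_i=1$ a plus; site $i$ is correspondingly a minus site or a plus site. $N$ is the number of minuses in the signal. The attacker knows all parameters and sees the signal $s$, but not the lock positions. She then allocates $m$ bombs: she chooses non-negative integers $u_1,\dots,u_n$ (depending on $s$) with $\sum_i u_i=m$. A locked site is never destroyed. In an unlocked site each bomb explodes with probability $p$, independently of everything else, and the site is destroyed if at least one of its bombs explodes; so an unlocked site with $u$ bombs is destroyed with probability $p(u)=1-q^u$, $q=1-p$ (with $q^0=1$). A strategy $\pi$ is a choice of allocation for each signal. Its value given $s$ is the conditional expected number of destroyed sites, $$w^\pi(s,m)=\sum_{i=1}^nP(T_i=0\mid s)\,p(u_i).$$ By symmetry the supremum of $w^\pi(s,m)$ over allocations depends on $s$ only through $x=N(s)$; this supremum is denoted $v(x,m)$. An optimal strategy is one attaining it for every $s$. $v(m)$ denotes the maximal (over all strategies) unconditional expected number of destroyed sites. For $0<x<n$ put $$p^-(x)=P(T_i=0\mid S_i=0,N=x),\quad p^+(x)=P(T_i=0\mid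 S_i=1,N=x),\quad r(x)=\frac{p^-(x)}{p^+(x)},$$ which do not depend on $i$. **UAP.** Distributing $m$ bombs UAP among $n$ sites means filling the sites one by one sequentially, layer by layer: with $m=ni+e$, $0\le e<n$, $e$ sites receive $i+1$ bombs and $n-e$ sites receive $i$ bombs. **$d$-UAP**, for an integer $d\ge1$ and a signal with $0<x<n$ minuses. Bombs are placed one at a time as follows, stopping when the bombs run out. First they are added one by one to the $x$ minus sites, layer by layer, until each minus site has $d$ bombs. Next they are added one by one to the $n-x$ plus sites until each has $1$ bomb. Next they are added one by one to the minus sites until each has $d+1$ bombs, then to the plus sites until each has $2$ bombs, and so on, alternating one layer in the minus sites with one layer in the plus sites. Which particular minus sites (or plus sites) receive the bombs of an incomplete layer does not matter. In the resulting allocation, $i$ is the number of complete layers in the minus sites and $e$, $0\le e<x$, the number of extra bombs in the incomplete layer of the minus sites; $j$ and $e'$, $0\le e'<n-x$, are the corresponding numbers for the plus sites. At most one of $e,e'$ is non-zero. The total numbers of bombs in minus and plus sites are $m^-=ix+e$ and $m^+=j(n-x)+e'$. *)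

theory Defs
  imports "HOL-Probability.Probability"
begin

text \<open>
  Locks, Bombs and Testing model with \<open>n\<close> sites \<open>{..<n}\<close>, \<open>k\<close> locks, test sensitivity \<open>a\<close>,
  test specificity \<open>b\<close>, explosion probability \<open>p\<close> and \<open>m\<close> bombs.
  A lock configuration is the set \<open>L\<close> of locked sites, so \<open>T\<^sub>i = 1\<close> means \<open>i \<in> L\<close>; a signal is a
  function \<open>s\<close> with \<open>s i\<close> true for a plus and false for a minus. Signals and allocations take
  their default value (\<open>False\<close>, \<open>0\<close>) outside \<open>{..<n}\<close>, so they correspond exactly to \<open>n\<close>-tuples.
\<close>

definition lock_sets :: "nat \<Rightarrow> nat \<Rightarrow> nat set set" where
  "lock_sets n k = {L. L \<subseteq> {..<n} \<and> card L = k}"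

definition signals :: "nat \<Rightarrow> (nat \<Rightarrow> bool) set" where
  "signals n = {s. \<forall>i\<ge>n. \<not> s i}"

definition minus_sites :: "nat \<Rightarrow> (nat \<Rightarrow> bool) \<Rightarrow> nat set" where
  "minus_sites n s = {i\<in>{..<n}. \<not> s i}"

definition plus_sites :: "nat \<Rightarrow> (nat \<Rightarrow> bool) \<Rightarrow> nat set" where
  "plus_sites n s = {i\<in>{..<n}. s i}"

definition num_minus :: "nat \<Rightarrow> (nat \<Rightarrow> bool) \<Rightarrow> nat" where
  "num_minus n s = card (minus_sites n s)"

definition test_pmf :: "nat \<Rightarrow> real \<Rightarrow> real \<Rightarrow> nat set \<Rightarrow> (nat \<Rightarrow> bool) pmf" where
  "test_pmf n a b L = Pi_pmf {..<n} False (\<lambda>i. bernoulli_pmf (if i \<in> L then a else 1 - b))"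

text \<open>Joint law of the lock configuration (first component) and the signal (second component).\<close>

definition lock_signal_pmf ::
    "nat \<Rightarrow> nat \<Rightarrow> real \<Rightarrow> real \<Rightarrow> (nat set \<times> (nat \<Rightarrow> bool)) pmf" where
  "lock_signal_pmf n k a b =
     bind_pmf (pmf_of_set (lock_sets n k)) (\<lambda>L.
     bind_pmf (test_pmf n a b L) (\<lambda>s. return_pmf (L, s)))"

definition prob_num_minus :: "nat \<Rightarrow> nat \<Rightarrow> real \<Rightarrow> real \<Rightarrow> nat \<Rightarrow> real" where
  "prob_num_minus n k a b x = \<P>(\<omega> in lock_signal_pmf n k a b. num_minus n (snd \<omega>) = x)"

definition posterior_unlocked ::
    "nat \<Rightarrow> nat \<Rightarrow> real \<Rightarrow> real \<Rightarrow> (nat \<Rightarrow> bool) \<Rightarrow> nat \<Rightarrow> real" where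
  "posterior_unlocked n k a b s i =
     \<P>(\<omega> in lock_signal_pmf n k a b. i \<notin> fst \<omega> \<bar> snd \<omega> = s)"

text \<open>
  \<open>p\<^sup>-(x)\<close> and \<open>p\<^sup>+(x)\<close> are the common values, over all sites \<open>i\<close>, of
  \<open>P(T\<^sub>i = 0 | S\<^sub>i = 0, N = x)\<close> and \<open>P(T\<^sub>i = 0 | S\<^sub>i = 1, N = x)\<close>; they are used for \<open>0 < x < n\<close> only.
\<close>

definition p_minus :: "nat \<Rightarrow> nat \<Rightarrow> real \<Rightarrow> real \<Rightarrow> nat \<Rightarrow> real" where
  "p_minus n k a b x = (THE y. \<forall>i<n. y =
     \<P>(\<omega> in lock_signal_pmf n k a b. i \<notin> fst \<omega> \<bar> \<not> snd \<omega> i \<and> num_minus n (snd \<omega>) = x))"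

definition p_plus :: "nat \<Rightarrow> nat \<Rightarrow> real \<Rightarrow> real \<Rightarrow> nat \<Rightarrow> real" where
  "p_plus n k a b x = (THE y. \<forall>i<n. y =
     \<P>(\<omega> in lock_signal_pmf n k a b. i \<notin> fst \<omega> \<bar> snd \<omega> i \<and> num_minus n (snd \<omega>) = x))"

definition ratio :: "nat \<Rightarrow> nat \<Rightarrow> real \<Rightarrow> real \<Rightarrow> nat \<Rightarrow> real" where
  "ratio n k a b x = p_minus n k a b x / p_plus n k a b x"

definition allocations :: "nat \<Rightarrow> nat \<Rightarrow> (nat \<Rightarrow> nat) set" where
  "allocations n m = {u. (\<forall>i\<ge>n. u i = 0) \<and> (\<Sum>i<n. u i) = m}"

definition strategies :: "nat \<Rightarrow> nat \<Rightarrow> ((nat \<Rightarrow> bool) \<Rightarrow> nat \<Rightarrow> nat) set" where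
  "strategies n m = (\<Pi>\<^sub>E s\<in>signals n. allocations n m)"

definition destroy_prob :: "real \<Rightarrow> nat \<Rightarrow> real" where
  "destroy_prob p u = 1 - (1 - p) ^ u"

definition alloc_value ::
    "nat \<Rightarrow> nat \<Rightarrow> real \<Rightarrow> real \<Rightarrow> real \<Rightarrow> (nat \<Rightarrow> bool) \<Rightarrow> (nat \<Rightarrow> nat) \<Rightarrow> real" where
  "alloc_value n k a b p s u =
     (\<Sum>i<n. posterior_unlocked n k a b s i * destroy_prob p (u i))"

definition signal_value ::
    "nat \<Rightarrow> nat \<Rightarrow> real \<Rightarrow> real \<Rightarrow> real \<Rightarrow> (nat \<Rightarrow> bool) \<Rightarrow> nat \<Rightarrow> real" where
  "signal_value n k a b p s m = (SUP u\<in>allocations n m. alloc_value n k a b p s u)"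

text \<open>A strategy is optimal iff its allocation is optimal, in the following sense, for every signal.\<close>

definition optimal_allocation ::
    "nat \<Rightarrow> nat \<Rightarrow> real \<Rightarrow> real \<Rightarrow> real \<Rightarrow> nat \<Rightarrow> (nat \<Rightarrow> bool) \<Rightarrow> (nat \<Rightarrow> nat) \<Rightarrow> bool" where
  "optimal_allocation n k a b p m s u \<longleftrightarrow>
     u \<in> allocations n m \<and> alloc_value n k a b p s u = signal_value n k a b p s m"

text \<open>\<open>v(x, m)\<close> is the common value of \<open>signal_value\<close> over all signals with \<open>x\<close> minuses.\<close>

definition minus_value :: "nat \<Rightarrow> nat \<Rightarrow> real \<Rightarrow> real \<Rightarrow> real \<Rightarrow> nat \<Rightarrow> nat \<Rightarrow> real" where
  "minus_value n k a b p x m =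
     (THE y. \<forall>s\<in>signals n. num_minus n s = x \<longrightarrow> y = signal_value n k a b p s m)"

text \<open>
  The full experiment under strategy \<open>\<pi>\<close>: lock configuration, signal, and for each unlocked site
  \<open>i\<close> and each \<open>c < \<pi> s i\<close> whether the \<open>c\<close>-th bomb placed at \<open>i\<close> explodes.
\<close>

definition outcome_pmf ::
    "nat \<Rightarrow> nat \<Rightarrow> real \<Rightarrow> real \<Rightarrow> real \<Rightarrow> ((nat \<Rightarrow> bool) \<Rightarrow> nat \<Rightarrow> nat) \<Rightarrow>
     (nat set \<times> (nat \<Rightarrow> bool) \<times> (nat \<times> nat \<Rightarrow> bool)) pmf" where
  "outcome_pmf n k a b p \<pi> =
     bind_pmf (lock_signal_pmf n k a b) (\<lambda>(L, s).
     bind_pmf (Pi_pmf (SIGMA i:{..<n} - L. {..<\<pi> s i}) False (\<lambda>_. bernoulli_pmf p)) (\<lambda>E.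
     return_pmf (L, s, E)))"

definition destroyed ::
    "nat \<Rightarrow> nat set \<Rightarrow> (nat \<Rightarrow> nat) \<Rightarrow> (nat \<times> nat \<Rightarrow> bool) \<Rightarrow> nat set" where
  "destroyed n L u E = {i\<in>{..<n} - L. \<exists>c<u i. E (i, c)}"

definition expected_destroyed ::
    "nat \<Rightarrow> nat \<Rightarrow> real \<Rightarrow> real \<Rightarrow> real \<Rightarrow> ((nat \<Rightarrow> bool) \<Rightarrow> nat \<Rightarrow> nat) \<Rightarrow> real" where
  "expected_destroyed n k a b p \<pi> =
     measure_pmf.expectation (outcome_pmf n k a b p \<pi>)
       (\<lambda>(L, s, E). real (card (destroyed n L (\<pi> s) E)))"

text \<open>The maximum below ranges over a finite set, since \<open>strategies n m\<close> is finite.\<close>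

definition total_value :: "nat \<Rightarrow> nat \<Rightarrow> real \<Rightarrow> real \<Rightarrow> real \<Rightarrow> nat \<Rightarrow> real" where
  "total_value n k a b p m = Max (expected_destroyed n k a b p ` strategies n m)"

text \<open>
  Placing bombs one at a time along a sequence of layers, each layer being the set of sites that
  receive one bomb in it. \<open>layered_fill layer t A u\<close> means that allocation \<open>u\<close> can be reached with
  layers \<open>0, \<dots>, t - 1\<close> complete and exactly the sites \<open>A\<close> of layer \<open>t\<close> already served.
\<close>

inductive layered_fill ::
    "(nat \<Rightarrow> nat set) \<Rightarrow> nat \<Rightarrow> nat set \<Rightarrow> (nat \<Rightarrow> nat) \<Rightarrow> bool"
  for layer :: "nat \<Rightarrow> nat set" where
  start: "layered_fill layer 0 {} (\<lambda>_. 0)"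
| place_bomb: "layered_fill layer t A u \<Longrightarrow> i \<in> layer t - A \<Longrightarrow>
     layered_fill layer t (insert i A) (u(i := u i + 1))"
| next_layer: "layered_fill layer t (layer t) u \<Longrightarrow> layered_fill layer (Suc t) {} u"

definition uap :: "nat \<Rightarrow> nat \<Rightarrow> (nat \<Rightarrow> nat) \<Rightarrow> bool" where
  "uap n m u \<longleftrightarrow> u \<in> allocations n m \<and> (\<exists>t A. layered_fill (\<lambda>_. {..<n}) t A u)"

text \<open>Layers \<open>0, \<dots>, d - 1\<close> are minus layers, layer \<open>d\<close> is a plus layer, and then they alternate.\<close>

definition d_uap_layer :: "nat \<Rightarrow> nat \<Rightarrow> (nat \<Rightarrow> bool) \<Rightarrow> nat \<Rightarrow> nat set" where
  "d_uap_layer n d s t = (if t < d \<or> odd (t - d) then minus_sites n s else plus_sites n s)"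

definition d_uap :: "nat \<Rightarrow> nat \<Rightarrow> nat \<Rightarrow> (nat \<Rightarrow> bool) \<Rightarrow> (nat \<Rightarrow> nat) \<Rightarrow> bool" where
  "d_uap n m d s u \<longleftrightarrow>
     u \<in> allocations n m \<and> (\<exists>t A. layered_fill (d_uap_layer n d s) t A u)"

definition complete_layers :: "nat set \<Rightarrow> (nat \<Rightarrow> nat) \<Rightarrow> nat" where
  "complete_layers B u = Min (u ` B)"

definition extra_bombs :: "nat set \<Rightarrow> (nat \<Rightarrow> nat) \<Rightarrow> nat" where
  "extra_bombs B u = (\<Sum>l\<in>B. u l - complete_layers B u)"

text \<open>\<open>(i, e, j, e')\<close> arises from a \<open>d\<close>-UAP allocation of \<open>m\<close> bombs for a signal with \<open>x\<close> minuses.\<close>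

definition d_uap_tuple :: "nat \<Rightarrow> nat \<Rightarrow> nat \<Rightarrow> nat \<Rightarrow> nat \<times> nat \<times> nat \<times> nat \<Rightarrow> bool" where
  "d_uap_tuple n m d x \<tau> \<longleftrightarrow>
     (\<exists>s\<in>signals n. \<exists>u. num_minus n s = x \<and> d_uap n m d s u \<and>
        \<tau> = (complete_layers (minus_sites n s) u, extra_bombs (minus_sites n s) u,
             complete_layers (plus_sites n s) u, extra_bombs (plus_sites n s) u))"

definition uap_level :: "nat \<Rightarrow> nat \<Rightarrow> real \<Rightarrow> real \<Rightarrow> real \<Rightarrow> nat \<Rightarrow> nat" where
  "uap_level n k a b p x = (LEAST i. 1 \<le> i \<and> ratio n k a b x * (1 - p) ^ i < 1)"

end

theory Submission
  imports Defs
begin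

text \<open>
  Given the signal, the attacker maximizes \<open>\<Sum>\<^sub>i w\<^sub>i (1 - q^(u i))\<close>, where \<open>w\<^sub>i\<close> is the posterior
  probability that site \<open>i\<close> is unlocked and \<open>q = 1 - p\<close>. This is a separable concave problem: the
  bomb that raises \<open>u i\<close> from \<open>t\<close> to \<open>t + 1\<close> gains \<open>p w\<^sub>i q^t\<close>, which decreases in \<open>t\<close>. An allocation is
  therefore optimal as soon as no single bomb can be moved with profit
  (\<open>exchange_condition_optimal\<close>).

  The lock positions are exchangeable and the sites are tested alike, so the joint law of locks and
  signal is invariant under permutations of the sites. Hence \<open>w\<^sub>i\<close> depends only on the sign of site
  \<open>i\<close> and on the number \<open>x\<close> of minuses (\<open>masses_symmetric\<close>), and \<open>p\<^sup>-(x)\<close>, \<open>p\<^sup>+(x)\<close> are these two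
  posteriors. If all signs agree, all \<open>w\<^sub>i\<close> are equal, their sum is \<open>n - k\<close>, and moving a bomb cannot
  pay when the \<open>u i\<close> differ by at most one: this is UAP. In general \<open>r(x) \<ge> 1\<close>, because moving a lock
  from a minus site to a plus site multiplies the likelihood by \<open>ab / ((1 - a)(1 - b)) \<ge> 1\<close>
  (\<open>unlocked_mass_plus_le_minus\<close>). By the choice of \<open>d = d(x)\<close> we have \<open>r q^d < 1 \<le> r q^(d - 1)\<close>, so a
  plus site with \<open>t\<close> bombs competes with minus sites having between \<open>d + t - 1\<close> and \<open>d + t\<close> bombs,
  and this is exactly the shift by \<open>d\<close> layers that \<open>d\<close>-UAP maintains.

  Everything needed about a \<open>d\<close>-UAP allocation is contained in one order-free property, \<open>staggered\<close>:
  the levels within the minus sites and within the plus sites differ by at most one, and the two groups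
  are shifted against each other by \<open>d\<close>, up to one layer. It implies the exchange condition
  (\<open>staggered_exchange\<close>), and together with the total number of bombs it determines the tuple
  \<open>(i, e, j, e')\<close> (\<open>staggered_tuple_unique\<close>). Finally, the expected number of destroyed sites of a
  strategy is the average over signals of the values of its allocations (\<open>expected_destroyed_eq\<close>), and
  a strategy may choose its allocation for each signal separately, so the maximum of the average is
  the average of the maxima.
\<close>

section \<open>Optimality from an exchange condition\<close>

text \<open>
  The increments between \<open>u\<close> and \<open>v\<close> are compared one by one with \<open>c\<close>; this is the tangent-line
  inequality for a concave sequence, with \<open>c\<close> any slope between the increments before and after \<open>u\<close>.
\<close>

lemma concave_seq_tangent:
  fixes g :: "nat \<Rightarrow> real"
  assumes up: "\<And>t. u \<le> t \<Longrightarrow> g (Suc t) - g t \<le> c"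
    and down: "\<And>t. t < u \<Longrightarrow> c \<le> g (Suc t) - g t"
  shows "g v - g u \<le> c * (real v - real u)"
proof (cases "u \<le> v")
  case True
  then show ?thesis
  proof (induction v rule: dec_induct)
    case (step t)
    then show ?case using up[of t] by (simp add: algebra_simps)
  qed simp
next
  case False
  then have "v \<le> u" by simp
  then show ?thesis
  proof (induction v rule: inc_induct)
    case (step t)
    then show ?case using down[of t] by (simp add: algebra_simps)
  qed simp
qed

lemma destroy_prob_increment: "destroy_prob p (Suc t) - destroy_prob p t = p * (1 - p) ^ t"
  by (simp add: destroy_prob_def algebra_simps)

text \<open>
  The largest gain \<open>c\<close> of any additional bomb serves as a Lagrange multiplier. By the exchange
  condition, every bomb already placed gains at least \<open>c\<close>, so each site obeys the tangent inequality
  with the same slope \<open>c\<close>; as both allocations use equally many bombs, the linear terms cancel in the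
  sum.
\<close>

lemma exchange_condition_optimal:
  fixes w :: "'a \<Rightarrow> real" and u v :: "'a \<Rightarrow> nat"
  assumes p: "0 \<le> p" "p \<le> 1" and fin: "finite I" and w: "\<And>i. i \<in> I \<Longrightarrow> 0 \<le> w i"
    and same: "sum v I = sum u I"
    and exch: "\<And>i j. i \<in> I \<Longrightarrow> j \<in> I \<Longrightarrow> 0 < u i \<Longrightarrow>
                 w j * (1 - p) ^ u j \<le> w i * (1 - p) ^ (u i - 1)"
  shows "(\<Sum>i\<in>I. w i * destroy_prob p (v i)) \<le> (\<Sum>i\<in>I. w i * destroy_prob p (u i))"
proof (cases "I = {}")
  case False
  define c where "c = p * Max ((\<lambda>j. w j * (1 - p) ^ u j) ` I)"
  have "w i * destroy_prob p (v i) - w i * destroy_prob p (u i) \<le> c * (real (v i) - real (u i))"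
    if i: "i \<in> I" for i
  proof (rule concave_seq_tangent)
    have inc: "w i * destroy_prob p (Suc t) - w i * destroy_prob p t = p * (w i * (1 - p) ^ t)" for t
      using destroy_prob_increment[of p t] by (simp add: algebra_simps)
    fix t
    {
      assume "u i \<le> t"
      then have "w i * (1 - p) ^ t \<le> w i * (1 - p) ^ u i"
        using p w[OF i] by (intro mult_left_mono power_decreasing) auto
      also have "\<dots> \<le> Max ((\<lambda>j. w j * (1 - p) ^ u j) ` I)"
        using fin i by (intro Max_ge) auto
      finally show "w i * destroy_prob p (Suc t) - w i * destroy_prob p t \<le> c"
        using p unfolding inc c_def by (intro mult_left_mono)
    }
    {
      assume t: "t < u i"
      have "Max ((\<lambda>j. w j * (1 - p) ^ u j) ` I) \<le> w i * (1 - p) ^ (u i - 1)"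
        using fin False exch[OF i] i t by (intro Max.boundedI) auto
      also have "\<dots> \<le> w i * (1 - p) ^ t"
        using p w[OF i] t by (intro mult_left_mono power_decreasing) auto
      finally show "c \<le> w i * destroy_prob p (Suc t) - w i * destroy_prob p t"
        using p unfolding inc c_def by (intro mult_left_mono)
    }
  qed
  then have "(\<Sum>i\<in>I. w i * destroy_prob p (v i) - w i * destroy_prob p (u i))
      \<le> (\<Sum>i\<in>I. c * (real (v i) - real (u i)))"
    by (rule sum_mono)
  also have "\<dots> = c * (real (sum v I) - real (sum u I))"
    by (simp add: sum_subtractf flip: sum_distrib_left)
  also have "\<dots> = 0"
    using same by simp
  finally show ?thesis
    by (simp add: sum_subtractf)
qed simp

section \<open>Layer-by-layer allocations\<close>

lemma sites_partition:
  "minus_sites n s \<union> plus_sites n s = {..<n}" "minus_sites n s \<inter> plus_sites n s = {}"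
  "finite (minus_sites n s)" "finite (plus_sites n s)"
  "card (minus_sites n s) = num_minus n s" "card (plus_sites n s) = n - num_minus n s"
proof -
  show *: "minus_sites n s \<union> plus_sites n s = {..<n}" "minus_sites n s \<inter> plus_sites n s = {}"
    "finite (minus_sites n s)" "finite (plus_sites n s)"
    by (auto simp: minus_sites_def plus_sites_def)
  show **: "card (minus_sites n s) = num_minus n s"
    by (simp add: num_minus_def)
  show "card (plus_sites n s) = n - num_minus n s"
    using card_Un_disjoint[OF *(3,4,2)] *(1) ** by simp
qed

lemma num_minus_le: "num_minus n s \<le> n"
  using card_mono[of "{..<n}" "minus_sites n s"] by (auto simp: num_minus_def minus_sites_def)

lemma quotient_remainder_unique:
  fixes c c' e e' z :: nat
  assumes "c * z + e = c' * z + e'" and "e < z" "e' < z"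
  shows "c = c'" and "e = e'"
  using arg_cong[OF assms(1), of "\<lambda>l. l div z"] arg_cong[OF assms(1), of "\<lambda>l. l mod z"] assms(2,3)
  by simp_all

definition balanced :: "'a set \<Rightarrow> ('a \<Rightarrow> nat) \<Rightarrow> bool" where
  "balanced B u \<longleftrightarrow> (\<forall>i\<in>B. \<forall>j\<in>B. u i \<le> Suc (u j))"

text \<open>
  If all levels on \<open>B\<close> differ by at most one, they are \<open>c\<close> or \<open>c + 1\<close> with \<open>c\<close> the minimum. The strict
  bound \<open>e < card B\<close> holds because the minimum is attained, also when a layer has just been completed;
  so \<open>c\<close> and \<open>e\<close> are quotient and remainder of the number of bombs on \<open>B\<close>.
\<close>

lemma balanced_levels:
  assumes B: "finite B" "B \<noteq> {}" and bal: "balanced B u"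
  defines "c \<equiv> complete_layers B u" and "e \<equiv> extra_bombs B u"
  shows balanced_sum: "sum u B = c * card B + e"
    and balanced_extra_less: "e < card B"
    and balanced_level_attained: "\<exists>i\<in>B. u i = c"
    and balanced_extra_pos: "0 < e \<Longrightarrow> \<exists>i\<in>B. u i = Suc c"
    and balanced_sum_apply: "(\<Sum>i\<in>B. f (u i)) = real e * f (c + 1) + (real (card B) - real e) * f c"
proof -
  have "Min (u ` B) \<in> u ` B"
    using B by (intro Min_in) auto
  then obtain i0 where i0: "i0 \<in> B" "u i0 = c"
    by (auto simp: c_def complete_layers_def)
  then show "\<exists>i\<in>B. u i = c" by blast
  have ge: "c \<le> u i" if "i \<in> B" for i
    using B that by (auto simp: c_def complete_layers_def)
  have le: "u i \<le> Suc c" if "i \<in> B" for i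
    using bal that i0 by (auto simp: balanced_def)
  define H where "H = {i \<in> B. u i = Suc c}"
  have lev: "u i = (if i \<in> H then Suc c else c)" if "i \<in> B" for i
    using ge[OF that] le[OF that] that by (auto simp: H_def)
  have HB: "H \<subseteq> B" "finite H" using B by (auto simp: H_def)
  have "e = (\<Sum>i\<in>B. if i \<in> H then 1 else 0)"
    unfolding e_def extra_bombs_def c_def[symmetric]
    by (intro sum.cong) (auto simp: lev)
  also have "\<dots> = card H"
    using B HB by (simp add: sum.If_cases Int_absorb1)
  finally have eH: "e = card H" .
  have "i0 \<notin> H" using i0 by (auto simp: H_def)
  then show "e < card B"
    unfolding eH using i0 HB B by (intro psubset_card_mono) auto
  show "\<exists>i\<in>B. u i = Suc c" if "0 < e"
    using that HB by (auto simp: eH H_def card_gt_0_iff)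
  have BH: "real (card (B \<inter> - H)) = real (card B) - real e"
    using HB B by (simp add: eH Diff_eq[symmetric] card_Diff_subset of_nat_diff card_mono)
  have "(\<Sum>i\<in>B. f (u i)) = (\<Sum>i\<in>B. if i \<in> H then f (Suc c) else f c)"
    by (intro sum.cong) (auto simp: lev)
  also have "\<dots> = real e * f (c + 1) + (real (card B) - real e) * f c"
    using B HB by (simp add: sum.If_cases Int_absorb1 BH eH[symmetric])
  finally show "(\<Sum>i\<in>B. f (u i)) = real e * f (c + 1) + (real (card B) - real e) * f c" .
  have "sum u B = (\<Sum>i\<in>B. c + (if i \<in> H then 1 else 0))"
    by (intro sum.cong) (auto simp: lev)
  also have "\<dots> = c * card B + e"
    using B HB by (simp add: sum.distrib sum.If_cases Int_absorb1 eH)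
  finally show "sum u B = c * card B + e" .
qed

text \<open>
  However the bombs of the layers were ordered, the level of a site is the number of completed layers
  that contain it, plus one if the site has been served in the current layer.
\<close>

lemma layered_fill_count:
  assumes "layered_fill layer t A u"
  shows "A \<subseteq> layer t \<and> (\<forall>i. u i = card {\<tau>. \<tau> < t \<and> i \<in> layer \<tau>} + (if i \<in> A then 1 else 0))"
  using assms
proof (induction rule: layered_fill.induct)
  case (next_layer t u)
  have "{\<tau>. \<tau> < Suc t \<and> i \<in> layer \<tau>} =
      (if i \<in> layer t then insert t {\<tau>. \<tau> < t \<and> i \<in> layer \<tau>} else {\<tau>. \<tau> < t \<and> i \<in> layer \<tau>})" for i
    by (auto simp: less_Suc_eq)
  then show ?case
    using next_layer by auto
qed auto

text \<open>
  As no layer is empty, after at most one change of layer there is a site for the next bomb.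
\<close>

lemma layered_fill_exists:
  assumes "\<And>\<tau>. layer \<tau> \<noteq> {}" and "\<And>\<tau>. layer \<tau> \<subseteq> {..<n}"
  shows "\<exists>t A u. layered_fill layer t A u \<and> u \<in> allocations n m"
proof (induction m)
  case 0
  show ?case
    by (intro exI conjI, rule layered_fill.start) (simp add: allocations_def)
next
  case (Suc m)
  then obtain t A u where fill: "layered_fill layer t A u" and u: "u \<in> allocations n m"
    by blast
  have "\<exists>t A. layered_fill layer t A u \<and> layer t - A \<noteq> {}"
  proof (cases "A = layer t")
    case True
    then have "layered_fill layer (Suc t) {} u"
      using fill by (auto intro: layered_fill.next_layer)
    then show ?thesis
      using assms(1) by (intro exI conjI) auto
  next
    case False
    then show ?thesis
      using fill layered_fill_count[OF fill] by blast
  qed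
  then obtain t A i where *: "layered_fill layer t A u" "i \<in> layer t - A"
    by blast
  have i: "i < n" using * assms(2)[of t] by blast
  have "(\<Sum>j<n. (u(i := u i + 1)) j) = (\<Sum>j<n. u j + (if j = i then 1 else 0))"
    by (intro sum.cong) auto
  also have "\<dots> = Suc m"
    using u i by (simp add: sum.distrib allocations_def)
  finally have "u(i := u i + 1) \<in> allocations n (Suc m)"
    using u i by (auto simp: allocations_def)
  then show ?case
    using layered_fill.place_bomb[OF *] by blast
qed

lemma uap_exists: "0 < n \<Longrightarrow> \<exists>u. uap n m u"
  unfolding uap_def using layered_fill_exists[of "\<lambda>_. {..<n}" n m] by auto

lemma uap_balanced:
  assumes "uap n m u"
  shows "balanced {..<n} u"
  using assms unfolding uap_def balanced_def by (auto dest!: layered_fill_count)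

lemma card_minus_layers_before:
  "card {\<tau>. \<tau> < t \<and> (\<tau> < d \<or> odd (\<tau> - d))} = (if t \<le> d then t else d + (t - d) div 2)"
proof (induction t)
  case (Suc t)
  have "{\<tau>. \<tau> < Suc t \<and> (\<tau> < d \<or> odd (\<tau> - d))} =
      (if t < d \<or> odd (t - d) then insert t {\<tau>. \<tau> < t \<and> (\<tau> < d \<or> odd (\<tau> - d))}
       else {\<tau>. \<tau> < t \<and> (\<tau> < d \<or> odd (\<tau> - d))})"
    by (auto simp: less_Suc_eq)
  then show ?case
    using Suc by (auto simp: Suc_diff_le not_less)
qed simp

lemma card_plus_layers_before:
  "card {\<tau>. \<tau> < t \<and> \<not> (\<tau> < d \<or> odd (\<tau> - d))} = Suc (t - d) div 2"
proof (induction t)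
  case (Suc t)
  have "{\<tau>. \<tau> < Suc t \<and> \<not> (\<tau> < d \<or> odd (\<tau> - d))} =
      (if t < d \<or> odd (t - d) then {\<tau>. \<tau> < t \<and> \<not> (\<tau> < d \<or> odd (\<tau> - d))}
       else insert t {\<tau>. \<tau> < t \<and> \<not> (\<tau> < d \<or> odd (\<tau> - d))})"
    by (auto simp: less_Suc_eq)
  then show ?case
    using Suc by (auto simp: Suc_diff_le not_less)
qed simp

text \<open>
  The traces that \<open>d\<close>-UAP leaves in the allocation: filling up to \<open>d + t\<close> layers in the minus sites
  \<open>M\<close> precedes layer \<open>t + 1\<close> of the plus sites \<open>P\<close>, which in turn precedes layer \<open>d + t + 1\<close> of \<open>M\<close>. In
  terms of levels, \<open>u i\<close> is at most \<open>d + u j\<close>, and at least \<open>d + u j - 1\<close> once \<open>j\<close> has a bomb.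
\<close>

definition staggered :: "nat \<Rightarrow> 'a set \<Rightarrow> 'a set \<Rightarrow> ('a \<Rightarrow> nat) \<Rightarrow> bool" where
  "staggered d M P u \<longleftrightarrow> balanced M u \<and> balanced P u \<and>
     (\<forall>i\<in>M. \<forall>j\<in>P. u i \<le> d + u j \<and> (0 < u j \<longrightarrow> d + u j \<le> Suc (u i)))"

lemma d_uap_exists:
  assumes "0 < num_minus n s" "num_minus n s < n"
  shows "\<exists>u. d_uap n m d s u"
proof -
  have "minus_sites n s \<noteq> {}" "plus_sites n s \<noteq> {}"
    using assms sites_partition(5,6)[of n s] by auto
  then have "\<exists>t A u. layered_fill (d_uap_layer n d s) t A u \<and> u \<in> allocations n m"
    by (intro layered_fill_exists)
      (auto simp: d_uap_layer_def minus_sites_def plus_sites_def split: if_splits)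
  then show ?thesis
    by (auto simp: d_uap_def)
qed

text \<open>
  When layers \<open>0, \<dots>, t - 1\<close> are complete, \<open>card_minus_layers_before\<close> and \<open>card_plus_layers_before\<close> count
  the layers of each kind among them. Only one group is being served in layer \<open>t\<close>, so the other one is
  level; the claim is then arithmetic in the three phases: the initial minus layers, the later minus
  layers \<open>t = d + 2h + 1\<close>, and the plus layers \<open>t = d + 2h\<close>.
\<close>

lemma d_uap_staggered:
  assumes "d_uap n m d s u"
  shows "staggered d (minus_sites n s) (plus_sites n s) u"
proof -
  obtain t A where "layered_fill (d_uap_layer n d s) t A u"
    using assms by (auto simp: d_uap_def)
  note cnt = layered_fill_count[OF this]
  have disj: "i \<notin> plus_sites n s" if "i \<in> minus_sites n s" for i
    using that by (auto simp: minus_sites_def plus_sites_def)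
  define mn where "mn = (if t \<le> d then t else d + (t - d) div 2)"
  define pl where "pl = Suc (t - d) div 2"
  have minus: "u i = mn + (if i \<in> A then 1 else 0)" if i: "i \<in> minus_sites n s" for i
  proof -
    have "{\<tau>. \<tau> < t \<and> i \<in> d_uap_layer n d s \<tau>} = {\<tau>. \<tau> < t \<and> (\<tau> < d \<or> odd (\<tau> - d))}"
      using i disj[OF i] by (auto simp: d_uap_layer_def)
    then have "card {\<tau>. \<tau> < t \<and> i \<in> d_uap_layer n d s \<tau>} = mn"
      by (simp only: card_minus_layers_before mn_def)
    then show ?thesis
      using cnt by simp
  qed
  have plus: "u i = pl + (if i \<in> A then 1 else 0)" if i: "i \<in> plus_sites n s" for i
  proof -
    have "{\<tau>. \<tau> < t \<and> i \<in> d_uap_layer n d s \<tau>} = {\<tau>. \<tau> < t \<and> \<not> (\<tau> < d \<or> odd (\<tau> - d))}"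
      using i disj[of i] by (auto simp: d_uap_layer_def)
    then have "card {\<tau>. \<tau> < t \<and> i \<in> d_uap_layer n d s \<tau>} = pl"
      by (simp only: card_plus_layers_before pl_def)
    then show ?thesis
      using cnt by simp
  qed
  have "u i \<le> d + u j \<and> (0 < u j \<longrightarrow> d + u j \<le> Suc (u i))"
    if i: "i \<in> minus_sites n s" and j: "j \<in> plus_sites n s" for i j
  proof (cases "t < d \<or> odd (t - d)")
    case True
    then have "j \<notin> A"
      using cnt j disj[of j] by (auto simp: d_uap_layer_def)
    then have uj: "u j = pl" using plus[OF j] by simp
    have ui: "mn \<le> u i" "u i \<le> Suc mn" using minus[OF i] by auto
    show ?thesis
    proof (cases "t < d")
      case True
      then show ?thesis using ui uj by (auto simp: mn_def pl_def)
    next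
      case False
      then obtain h where "t = d + (2 * h + 1)"
        using True by (metis le_add_diff_inverse not_less oddE)
      then show ?thesis using ui uj by (auto simp: mn_def pl_def)
    qed
  next
    case False
    then have "i \<notin> A"
      using cnt i disj[of i] by (auto simp: d_uap_layer_def)
    then have ui: "u i = mn" using minus[OF i] by simp
    have uj: "pl \<le> u j" "u j \<le> Suc pl" using plus[OF j] by auto
    obtain h where "t = d + 2 * h"
      using False by (metis evenE le_add_diff_inverse not_less)
    then show ?thesis using ui uj by (auto simp: mn_def pl_def)
  qed
  then show ?thesis
    by (auto simp: staggered_def balanced_def minus plus)
qed

text \<open>
  The two inequalities between the weights say that bomb number \<open>d\<close> on a minus site is worth at least
  the first bomb on a plus site, and that bomb number \<open>d + 1\<close> is worth at most that. Multiplying by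
  powers of \<open>q\<close> compares all other pairs of bombs.
\<close>

lemma staggered_exchange:
  fixes wm wp q :: real
  assumes stag: "staggered d M P u" and q: "0 \<le> q" "q \<le> 1" and w: "0 \<le> wm" "0 \<le> wp"
    and first: "wp \<le> wm * q ^ (d - 1)" and last: "wm * q ^ d \<le> wp" and d: "1 \<le> d"
    and wM: "\<And>i. i \<in> M \<Longrightarrow> w i = wm" and wP: "\<And>i. i \<in> P \<Longrightarrow> w i = wp"
    and ij: "i \<in> M \<union> P" "j \<in> M \<union> P" and pos: "0 < u i"
  shows "w j * q ^ u j \<le> w i * q ^ (u i - 1)"
proof -
  have same: "c * q ^ u j \<le> c * q ^ (u i - 1)" if "u i \<le> Suc (u j)" "0 \<le> c" for c
    using that q by (intro mult_left_mono power_decreasing) auto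
  consider "i \<in> M" "j \<in> M" | "i \<in> P" "j \<in> P" | "i \<in> M" "j \<in> P" | "i \<in> P" "j \<in> M"
    using ij by blast
  then show ?thesis
  proof cases
    case 1
    then show ?thesis using stag same w by (auto simp: wM staggered_def balanced_def)
  next
    case 2
    then show ?thesis using stag same w by (auto simp: wP staggered_def balanced_def)
  next
    case 3
    then have "u i - 1 \<le> (d - 1) + u j"
      using stag d by (fastforce simp: staggered_def)
    then have "wm * q ^ ((d - 1) + u j) \<le> wm * q ^ (u i - 1)"
      using q w by (intro mult_left_mono power_decreasing) auto
    moreover have "wp * q ^ u j \<le> wm * q ^ (d - 1) * q ^ u j"
      using first q by (intro mult_right_mono) auto
    ultimately show ?thesis
      using 3 by (simp add: wM wP power_add mult.assoc)
  next
    case 4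
    then have "d + (u i - 1) \<le> u j"
      using stag pos by (fastforce simp: staggered_def)
    then have "wm * q ^ u j \<le> wm * q ^ (d + (u i - 1))"
      using q w by (intro mult_left_mono power_decreasing) auto
    moreover have "wm * q ^ d * q ^ (u i - 1) \<le> wp * q ^ (u i - 1)"
      using last q by (intro mult_right_mono) auto
    ultimately show ?thesis
      using 4 by (simp add: wM wP power_add mult.assoc)
  qed
qed

text \<open>
  The condition \<open>staggered\<close> in terms of complete layers and extra bombs, for \<open>x\<close> minus and \<open>y\<close> plus
  sites. The cases \<open>0 < e\<close> and \<open>0 < e'\<close> come from sites at the upper levels \<open>i + 1\<close> and \<open>j + 1\<close>; these
  two cases exclude each other.
\<close>

definition staggered_tuple :: "nat \<Rightarrow> nat \<Rightarrow> nat \<Rightarrow> nat \<times> nat \<times> nat \<times> nat \<Rightarrow> bool" where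
  "staggered_tuple d x y = (\<lambda>(i, e, j, e'). e < x \<and> e' < y \<and>
     i \<le> d + j \<and> (0 < e \<longrightarrow> Suc i \<le> d + j) \<and>
     (0 < j \<longrightarrow> d + j \<le> Suc i) \<and> (0 < e' \<longrightarrow> d + j \<le> i))"

lemma staggered_tupleI:
  assumes stag: "staggered d M P u" and M: "finite M" "M \<noteq> {}" and P: "finite P" "P \<noteq> {}"
  shows "staggered_tuple d (card M) (card P)
    (complete_layers M u, extra_bombs M u, complete_layers P u, extra_bombs P u)"
proof -
  have bal: "balanced M u" "balanced P u"
    and st: "\<And>i j. i \<in> M \<Longrightarrow> j \<in> P \<Longrightarrow> u i \<le> d + u j \<and> (0 < u j \<longrightarrow> d + u j \<le> Suc (u i))"
    using stag by (auto simp: staggered_def)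
  obtain i j where "i \<in> M" "u i = complete_layers M u" "j \<in> P" "u j = complete_layers P u"
    using balanced_level_attained[OF M bal(1)] balanced_level_attained[OF P bal(2)] by blast
  note ij = this
  have "Suc (complete_layers M u) \<le> d + complete_layers P u" if "0 < extra_bombs M u"
    using balanced_extra_pos[OF M bal(1) that] st[OF _ ij(3)] ij by force
  moreover have "d + complete_layers P u \<le> complete_layers M u" if "0 < extra_bombs P u"
    using balanced_extra_pos[OF P bal(2) that] st[OF ij(1)] ij by force
  ultimately show ?thesis
    using st[OF ij(1,3)] ij balanced_extra_less[OF M bal(1)] balanced_extra_less[OF P bal(2)]
    by (auto simp: staggered_tuple_def)
qed

text \<open>
  More bombs on the plus sites force at least as many on the minus sites: the higher top level of the
  plus sites lifts even the lowest minus sites to the top level of the other allocation.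
\<close>

lemma staggered_tuple_minus_le:
  assumes t1: "staggered_tuple d x y (i1, e1, j1, e1')"
    and t2: "staggered_tuple d x y (i2, e2, j2, e2')"
    and less: "j1 * y + e1' < j2 * y + e2'"
  shows "i1 * x + e1 \<le> i2 * x + e2"
proof -
  \<comment> \<open>\<open>J2\<close> is the number of started plus layers, that is, the top level of the plus sites.\<close>
  define J2 where "J2 = j2 + (if 0 < e2' then 1 else 0)"
  have "j2 * y + e2' \<le> J2 * y"
    using t2 by (auto simp: J2_def staggered_tuple_def)
  then have "j1 * y < J2 * y" using less by linarith
  then have J: "j1 < J2" by simp
  then have "d + J2 \<le> Suc i2"
    using t2 by (auto simp: J2_def staggered_tuple_def split: if_splits)
  then have "i1 + (if 0 < e1 then 1 else 0) \<le> i2"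
    using t1 J by (auto simp: staggered_tuple_def)
  then have "(i1 + (if 0 < e1 then 1 else 0)) * x \<le> i2 * x"
    by (rule mult_le_mono1)
  moreover have "i1 * x + e1 \<le> (i1 + (if 0 < e1 then 1 else 0)) * x"
    using t1 by (auto simp: staggered_tuple_def)
  ultimately show ?thesis by linarith
qed

text \<open>
  For a fixed total, monotonicity fixes how the bombs split between the two groups; the tuple then
  consists of quotients and remainders.
\<close>

lemma staggered_tuple_unique:
  assumes t1: "staggered_tuple d x y (i1, e1, j1, e1')"
    and t2: "staggered_tuple d x y (i2, e2, j2, e2')"
    and sum: "(i1 * x + e1) + (j1 * y + e1') = (i2 * x + e2) + (j2 * y + e2')"
  shows "(i1, e1, j1, e1') = (i2, e2, j2, e2')"
proof -
  have "j1 * y + e1' = j2 * y + e2'"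
    using staggered_tuple_minus_le[OF t1 t2] staggered_tuple_minus_le[OF t2 t1] sum by linarith
  moreover from this have "i1 * x + e1 = i2 * x + e2"
    using sum by simp
  ultimately show ?thesis
    using t1 t2 quotient_remainder_unique[of i1 x e1 i2 e2]
      quotient_remainder_unique[of j1 y e1' j2 e2']
    by (simp add: staggered_tuple_def)
qed

section \<open>The joint law of locks and signal\<close>

lemma finite_signals: "finite (signals n)"
proof -
  have "signals n = PiE_dflt {..<n} False (\<lambda>_. UNIV)"
    by (auto simp: signals_def PiE_dflt_def not_less)
  then show ?thesis
    by (simp add: finite_PiE_dflt)
qed

lemma finite_lock_sets: "finite (lock_sets n k)"
  by (simp add: lock_sets_def)

lemma lock_sets_nonempty: "k \<le> n \<Longrightarrow> lock_sets n k \<noteq> {}"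
  using obtain_subset_with_card_n[of k "{..<n}"] by (auto simp: lock_sets_def)

lemma finite_allocations: "finite (allocations n m)"
proof (rule finite_subset)
  show "allocations n m \<subseteq> PiE_dflt {..<n} 0 (\<lambda>_. {..m})"
    by (auto simp: allocations_def PiE_dflt_def intro: member_le_sum)
qed (simp add: finite_PiE_dflt)

lemma signal_value_eqI:
  assumes "u \<in> allocations n m"
    and "\<And>v. v \<in> allocations n m \<Longrightarrow> alloc_value n k a b p s v \<le> alloc_value n k a b p s u"
  shows "signal_value n k a b p s m = alloc_value n k a b p s u"
  unfolding signal_value_def using assms by (intro cSup_eq_maximum) auto

lemma alloc_value_le_signal_value:
  "u \<in> allocations n m \<Longrightarrow> alloc_value n k a b p s u \<le> signal_value n k a b p s m"
  unfolding signal_value_def using finite_allocations by (intro cSUP_upper) auto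

definition test_lik :: "real \<Rightarrow> real \<Rightarrow> bool \<Rightarrow> bool \<Rightarrow> real" where
  "test_lik a b locked is_plus =
     (if locked then (if is_plus then a else 1 - a) else (if is_plus then 1 - b else b))"

definition signal_mass :: "nat \<Rightarrow> nat \<Rightarrow> real \<Rightarrow> real \<Rightarrow> (nat \<Rightarrow> bool) \<Rightarrow> real" where
  "signal_mass n k a b s = (\<Sum>L\<in>lock_sets n k. pmf (lock_signal_pmf n k a b) (L, s))"

definition unlocked_mass :: "nat \<Rightarrow> nat \<Rightarrow> real \<Rightarrow> real \<Rightarrow> (nat \<Rightarrow> bool) \<Rightarrow> nat \<Rightarrow> real" where
  "unlocked_mass n k a b s i =
     (\<Sum>L | L \<in> lock_sets n k \<and> i \<notin> L. pmf (lock_signal_pmf n k a b) (L, s))"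

text \<open>
  All probabilities are expressed through the masses \<open>P(S = s)\<close> and \<open>P(i \<notin> L, S = s)\<close>. The
  assumptions make every signal possible, and every site unlocked with positive probability whatever
  the signal, so that no conditional probability below is a division by zero.
\<close>

locale lock_test_model =
  fixes n k :: nat and a b :: real
  assumes k_less: "k < n" and a: "0 < a" "a < 1" and b: "0 < b" "b < 1"
begin

lemma test_lik_pos: "0 < test_lik a b l t"
  using a b by (simp add: test_lik_def)

lemma pmf_test_pmf:
  assumes "s \<in> signals n"
  shows "pmf (test_pmf n a b L) s = (\<Prod>i<n. test_lik a b (i \<in> L) (s i))"
proof -
  have "pmf (test_pmf n a b L) s =
      (\<Prod>i<n. pmf (bernoulli_pmf (if i \<in> L then a else 1 - b)) (s i))"
    unfolding test_pmf_def using assms by (subst pmf_Pi') (auto simp: signals_def)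
  also have "\<dots> = (\<Prod>i<n. test_lik a b (i \<in> L) (s i))"
    using a b by (intro prod.cong) (auto simp: test_lik_def)
  finally show ?thesis .
qed

lemma pmf_lock_signal:
  assumes "L \<in> lock_sets n k" and "s \<in> signals n"
  shows "pmf (lock_signal_pmf n k a b) (L, s) =
    (\<Prod>i<n. test_lik a b (i \<in> L) (s i)) / real (card (lock_sets n k))"
proof -
  have eq: "bind_pmf (test_pmf n a b L') (\<lambda>s. return_pmf (L', s)) =
      map_pmf (Pair L') (test_pmf n a b L')" for L'
    by (simp add: map_pmf_def)
  have one: "pmf (map_pmf (Pair L') (test_pmf n a b L')) (L, s) =
      (if L' = L then pmf (test_pmf n a b L) s else 0)" for L'
    by (auto simp: pmf_map_inj' inj_on_def pmf_eq_0_set_pmf)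
  have "pmf (lock_signal_pmf n k a b) (L, s) =
      (\<Sum>L'\<in>lock_sets n k. if L' = L then pmf (test_pmf n a b L) s else 0) / real (card (lock_sets n k))"
    unfolding lock_signal_pmf_def eq
    by (subst pmf_bind_pmf_of_set) (use k_less in \<open>auto simp: one lock_sets_nonempty finite_lock_sets\<close>)
  then show ?thesis
    using assms by (simp add: finite_lock_sets pmf_test_pmf)
qed

lemma pmf_lock_signal_pos:
  "L \<in> lock_sets n k \<Longrightarrow> s \<in> signals n \<Longrightarrow> 0 < pmf (lock_signal_pmf n k a b) (L, s)"
  using finite_lock_sets[of n k]
  by (auto simp: pmf_lock_signal card_gt_0_iff intro!: divide_pos_pos prod_pos test_lik_pos)

lemma set_pmf_lock_signal: "set_pmf (lock_signal_pmf n k a b) \<subseteq> lock_sets n k \<times> signals n"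
proof -
  have "set_pmf (test_pmf n a b L) \<subseteq> signals n" for L
    unfolding test_pmf_def signals_def by (rule order.trans[OF set_Pi_pmf_subset]) auto
  then show ?thesis
    using k_less by (auto simp: lock_signal_pmf_def lock_sets_nonempty finite_lock_sets)
qed

lemma prob_lock_signal:
  "\<P>(\<omega> in lock_signal_pmf n k a b. Q (fst \<omega>) (snd \<omega>)) =
   (\<Sum>s\<in>signals n. \<Sum>L | L \<in> lock_sets n k \<and> Q L s. pmf (lock_signal_pmf n k a b) (L, s))"
proof -
  let ?S = "SIGMA s:signals n. {L. L \<in> lock_sets n k \<and> Q L s}"
  have fin: "finite ?S"
    by (intro finite_SigmaI finite_signals) (simp add: finite_lock_sets)
  have "\<P>(\<omega> in lock_signal_pmf n k a b. Q (fst \<omega>) (snd \<omega>)) =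
      measure_pmf.prob (lock_signal_pmf n k a b) (prod.swap ` ?S)"
    by (rule measure_prob_cong_0)
      (use set_pmf_lock_signal in \<open>force simp: image_iff pmf_eq_0_set_pmf\<close>)+
  also have "\<dots> = (\<Sum>\<omega>\<in>prod.swap ` ?S. pmf (lock_signal_pmf n k a b) \<omega>)"
    using fin by (intro measure_measure_pmf_finite) auto
  also have "\<dots> = (\<Sum>(s, L)\<in>?S. pmf (lock_signal_pmf n k a b) (L, s))"
    by (subst sum.reindex) (auto simp: case_prod_beta prod.swap_def)
  also have "\<dots> = (\<Sum>s\<in>signals n. \<Sum>L | L \<in> lock_sets n k \<and> Q L s. pmf (lock_signal_pmf n k a b) (L, s))"
    by (subst sum.Sigma) (auto simp: finite_signals finite_lock_sets)
  finally show ?thesis .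
qed

lemma signal_mass_pos: "s \<in> signals n \<Longrightarrow> 0 < signal_mass n k a b s"
  unfolding signal_mass_def using k_less
  by (intro sum_pos finite_lock_sets lock_sets_nonempty pmf_lock_signal_pos) auto

lemma unlocked_mass_pos:
  assumes "s \<in> signals n" and "i < n"
  shows "0 < unlocked_mass n k a b s i"
proof -
  have "k \<le> card ({..<n} - {i})"
    using k_less assms(2) by simp
  then obtain L where "L \<subseteq> {..<n} - {i}" "card L = k"
    by (rule obtain_subset_with_card_n) blast
  then have "L \<in> {L. L \<in> lock_sets n k \<and> i \<notin> L}"
    by (auto simp: lock_sets_def)
  then show ?thesis
    unfolding unlocked_mass_def using assms
    by (intro sum_pos) (auto simp: finite_lock_sets intro: pmf_lock_signal_pos)
qed

lemma prob_signals:
  "\<P>(\<omega> in lock_signal_pmf n k a b. Q (snd \<omega>)) = (\<Sum>s | s \<in> signals n \<and> Q s. signal_mass n k a b s)"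
proof -
  have "\<P>(\<omega> in lock_signal_pmf n k a b. Q (snd \<omega>)) =
      (\<Sum>s\<in>signals n. if Q s then signal_mass n k a b s else 0)"
    using prob_lock_signal[of "\<lambda>_. Q"] by (auto simp: signal_mass_def intro!: sum.cong)
  then show ?thesis
    by (simp add: sum.inter_filter finite_signals)
qed

lemma prob_unlocked_signals:
  "\<P>(\<omega> in lock_signal_pmf n k a b. i \<notin> fst \<omega> \<and> Q (snd \<omega>)) =
   (\<Sum>s | s \<in> signals n \<and> Q s. unlocked_mass n k a b s i)"
proof -
  have "\<P>(\<omega> in lock_signal_pmf n k a b. i \<notin> fst \<omega> \<and> Q (snd \<omega>)) =
      (\<Sum>s\<in>signals n. if Q s then unlocked_mass n k a b s i else 0)"
    using prob_lock_signal[of "\<lambda>L s. i \<notin> L \<and> Q s"]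
    by (auto simp: unlocked_mass_def intro!: sum.cong)
  then show ?thesis
    by (simp add: sum.inter_filter finite_signals)
qed

lemma posterior_unlocked_eq:
  assumes "s \<in> signals n"
  shows "posterior_unlocked n k a b s i = unlocked_mass n k a b s i / signal_mass n k a b s"
proof -
  have "{s'. s' \<in> signals n \<and> s' = s} = {s}"
    using assms by auto
  then show ?thesis
    unfolding posterior_unlocked_def cond_prob_def
    using prob_unlocked_signals[of i "\<lambda>s'. s' = s"] prob_signals[of "\<lambda>s'. s' = s"] by simp
qed

lemma posterior_unlocked_pos:
  "s \<in> signals n \<Longrightarrow> i < n \<Longrightarrow> 0 < posterior_unlocked n k a b s i"
  by (simp add: posterior_unlocked_eq unlocked_mass_pos signal_mass_pos)

section \<open>Symmetry of the posterior\<close>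

text \<open>
  Permuting the sites of both the lock set and the signal only reorders the factors of the likelihood,
  and it permutes the lock sets among themselves.
\<close>

lemma permuted_masses:
  assumes bij: "bij_betw \<sigma> {..<n} {..<n}" and s: "s \<in> signals n" and s': "s' \<in> signals n"
    and perm: "\<And>i. i < n \<Longrightarrow> s' (\<sigma> i) = s i"
  shows "signal_mass n k a b s' = signal_mass n k a b s"
    and "i < n \<Longrightarrow> unlocked_mass n k a b s' (\<sigma> i) = unlocked_mass n k a b s i"
proof -
  have inj: "inj_on \<sigma> {..<n}" and im: "\<sigma> ` {..<n} = {..<n}"
    using bij by (auto simp: bij_betw_def)
  have sub: "L \<subseteq> {..<n}" if "L \<in> lock_sets n k" for L
    using that by (auto simp: lock_sets_def)
  have mem: "\<sigma> i \<in> \<sigma> ` L \<longleftrightarrow> i \<in> L" if "i < n" "L \<in> lock_sets n k" for i L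
    using inj_on_image_mem_iff[OF inj _ sub[OF that(2)], of i] that by simp
  have bijL: "bij_betw (image \<sigma>) (lock_sets n k) (lock_sets n k)"
  proof (rule bij_betw_subset[OF bij_betw_Pow[OF bij]])
    show "lock_sets n k \<subseteq> Pow {..<n}"
      using sub by blast
    show "image \<sigma> ` lock_sets n k = lock_sets n k"
    proof (rule card_subset_eq)
      show img: "image \<sigma> ` lock_sets n k \<subseteq> lock_sets n k"
        using im inj by (fastforce simp: lock_sets_def card_image inj_on_subset)
      show "card (image \<sigma> ` lock_sets n k) = card (lock_sets n k)"
        using inj_on_image_Pow[OF inj] sub by (intro card_image) (auto elim!: inj_on_subset)
    qed (rule finite_lock_sets)
  qed
  have weight: "pmf (lock_signal_pmf n k a b) (\<sigma> ` L, s') = pmf (lock_signal_pmf n k a b) (L, s)"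
    if L: "L \<in> lock_sets n k" for L
  proof -
    have "(\<Prod>i<n. test_lik a b (i \<in> \<sigma> ` L) (s' i)) =
        (\<Prod>i<n. test_lik a b (\<sigma> i \<in> \<sigma> ` L) (s' (\<sigma> i)))"
      by (rule prod.reindex_bij_betw[OF bij, symmetric])
    also have "\<dots> = (\<Prod>i<n. test_lik a b (i \<in> L) (s i))"
      using L by (intro prod.cong) (auto simp: mem perm)
    finally show ?thesis
      using L s s' bij_betwE[OF bijL] by (simp add: pmf_lock_signal)
  qed
  show "signal_mass n k a b s' = signal_mass n k a b s"
    unfolding signal_mass_def
    by (subst sum.reindex_bij_betw[OF bijL, symmetric]) (simp add: weight)
  assume i: "i < n"
  have "bij_betw (image \<sigma>) {L. L \<in> lock_sets n k \<and> i \<notin> L} {L. L \<in> lock_sets n k \<and> \<sigma> i \<notin> L}"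
  proof (rule bij_betw_subset[OF bijL])
    show "image \<sigma> ` {L. L \<in> lock_sets n k \<and> i \<notin> L} = {L. L \<in> lock_sets n k \<and> \<sigma> i \<notin> L}"
      using bij_betw_imp_surj_on[OF bijL] mem[OF i] by blast
  qed auto
  then show "unlocked_mass n k a b s' (\<sigma> i) = unlocked_mass n k a b s i"
    unfolding unlocked_mass_def
    by (subst sum.reindex_bij_betw[symmetric], assumption) (simp add: weight)
qed

text \<open>
  Two signals with the same number of minuses are related by a permutation of the sites, which can be
  chosen to carry a prescribed site to any prescribed site with the same sign.
\<close>

lemma masses_symmetric:
  assumes s: "s \<in> signals n" and s': "s' \<in> signals n" and N: "num_minus n s = num_minus n s'"
    and i: "i < n" and i': "i' < n" and sign: "s i = s' i'"
  shows "signal_mass n k a b s = signal_mass n k a b s'"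
    and "unlocked_mass n k a b s i = unlocked_mass n k a b s' i'"
proof -
  have cm: "card (minus_sites n s) = card (minus_sites n s')"
    and cp: "card (plus_sites n s) = card (plus_sites n s')"
    using N by (simp_all add: sites_partition)
  \<comment> \<open>Equinumerous sets admit a bijection that respects the distinguished points.\<close>
  have pointed: "\<exists>f. bij_betw f A A' \<and> (i \<in> A \<longrightarrow> f i = i')"
    if "finite A" "finite A'" "card A = card A'" "i \<in> A \<longleftrightarrow> i' \<in> A'" for A A'
  proof (cases "i \<in> A")
    case True
    then have c: "card (A - {i}) = card (A' - {i'})" "finite (A - {i})" "finite (A' - {i'})"
      using that by simp_all
    obtain f where "bij_betw f (A - {i}) (A' - {i'})"
      using finite_same_card_bij[OF c(2,3,1)] by blast
    then have "bij_betw (f(i := i')) (A - {i}) (A' - {i'})"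
      by (rule bij_betw_cong[THEN iffD1, rotated]) auto
    then have "bij_betw (f(i := i')) (A - {i} \<union> {i}) (A' - {i'} \<union> {i'})"
      by (rule bij_betw_combine) auto
    moreover have "A - {i} \<union> {i} = A" "A' - {i'} \<union> {i'} = A'"
      using True that by auto
    ultimately have "bij_betw (f(i := i')) A A'"
      by simp
    then show ?thesis by (intro exI[of _ "f(i := i')"]) auto
  next
    case False
    then show ?thesis using finite_same_card_bij[OF that(1,2,3)] by blast
  qed
  obtain f where f: "bij_betw f (minus_sites n s) (minus_sites n s')" "i \<in> minus_sites n s \<longrightarrow> f i = i'"
    using pointed[OF sites_partition(3,3) cm] i i' sign by (auto simp: minus_sites_def)
  obtain g where g: "bij_betw g (plus_sites n s) (plus_sites n s')" "i \<in> plus_sites n s \<longrightarrow> g i = i'"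
    using pointed[OF sites_partition(4,4) cp] i i' sign by (auto simp: plus_sites_def)
  define \<sigma> where "\<sigma> l = (if l \<in> minus_sites n s then f l else g l)" for l
  have bij: "bij_betw \<sigma> {..<n} {..<n}"
    using bij_betw_disjoint_Un[OF f(1) g(1) sites_partition(2,2)]
    by (simp add: sites_partition(1) \<sigma>_def[abs_def])
  have perm: "s' (\<sigma> l) = s l" if "l < n" for l
    using that bij_betwE[OF f(1)] bij_betwE[OF g(1)]
    by (auto simp: \<sigma>_def minus_sites_def plus_sites_def)
  have \<sigma>i: "\<sigma> i = i'"
    using f g i by (auto simp: \<sigma>_def minus_sites_def plus_sites_def)
  show "signal_mass n k a b s = signal_mass n k a b s'"
    using permuted_masses(1)[OF bij s s' perm] by simp
  show "unlocked_mass n k a b s i = unlocked_mass n k a b s' i'"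
    using permuted_masses(2)[OF bij s s' perm i] by (simp add: \<sigma>i)
qed

lemma ex_signal_at:
  assumes "i < n" and "if t then x < n else 0 < x" and "x \<le> n"
  shows "\<exists>s\<in>signals n. num_minus n s = x \<and> s i = t"
proof -
  have "\<exists>M. M \<subseteq> {..<n} \<and> card M = x \<and> (i \<in> M \<longleftrightarrow> \<not> t)"
  proof (cases t)
    case True
    then have "x \<le> card ({..<n} - {i})"
      using assms by simp
    then obtain M where "M \<subseteq> {..<n} - {i}" "card M = x"
      by (rule obtain_subset_with_card_n) blast
    then show ?thesis
      using True by blast
  next
    case False
    then have "x - 1 \<le> card ({..<n} - {i})"
      using assms by simp
    then obtain M where "M \<subseteq> {..<n} - {i}" "card M = x - 1"
      by (rule obtain_subset_with_card_n) blast
    moreover from this have "finite M" "i \<notin> M"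
      by (auto intro: finite_subset)
    ultimately show ?thesis
      using False assms by (intro exI[of _ "insert i M"]) auto
  qed
  then obtain M where M: "M \<subseteq> {..<n}" "card M = x" "i \<in> M \<longleftrightarrow> \<not> t"
    by blast
  let ?s = "\<lambda>l. l < n \<and> l \<notin> M"
  have "minus_sites n ?s = M"
    using M by (auto simp: minus_sites_def)
  then show ?thesis
    using M assms by (intro bexI[of _ ?s]) (auto simp: num_minus_def signals_def)
qed

text \<open>
  Conditioning on the sign of one site and on the number of minuses averages over signals that all have
  the same mass and the same mass of \<open>j\<close> being unlocked; hence it gives the same answer as conditioning
  on the full signal.
\<close>

lemma posterior_given_count:
  assumes s: "s \<in> signals n" and i: "i < n" and j: "j < n"
  shows "\<P>(\<omega> in lock_signal_pmf n k a b.
      j \<notin> fst \<omega> \<bar> snd \<omega> j = s i \<and> num_minus n (snd \<omega>) = num_minus n s)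
    = posterior_unlocked n k a b s i"
proof -
  let ?R = "{r. r \<in> signals n \<and> r j = s i \<and> num_minus n r = num_minus n s}"
  have "if s i then num_minus n s < n else 0 < num_minus n s"
    using i psubset_card_mono[of "{..<n}" "minus_sites n s"]
    by (auto simp: num_minus_def minus_sites_def card_gt_0_iff)
  then have ne: "?R \<noteq> {}"
    using ex_signal_at[OF j _ num_minus_le] by blast
  have fin: "finite ?R"
    using finite_signals by simp
  have "(\<Sum>r\<in>?R. unlocked_mass n k a b r j) = real (card ?R) * unlocked_mass n k a b s i"
    using masses_symmetric(2)[OF _ s _ j i] by simp
  moreover have "(\<Sum>r\<in>?R. signal_mass n k a b r) = real (card ?R) * signal_mass n k a b s"
    using masses_symmetric(1)[OF _ s _ j i] by simp
  moreover have "card ?R \<noteq> 0"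
    using ne fin by simp
  ultimately show ?thesis
    unfolding cond_prob_def
    using prob_unlocked_signals[of j "\<lambda>r. r j = s i \<and> num_minus n r = num_minus n s"]
      prob_signals[of "\<lambda>r. r j = s i \<and> num_minus n r = num_minus n s"]
    by (simp add: posterior_unlocked_eq[OF s])
qed

lemma posterior_minus:
  assumes s: "s \<in> signals n" and i: "i < n" "\<not> s i"
  shows "posterior_unlocked n k a b s i = p_minus n k a b (num_minus n s)"
  unfolding p_minus_def
  using posterior_given_count[OF s i(1)] i
  by (intro the_equality[symmetric]) auto

lemma posterior_plus:
  assumes s: "s \<in> signals n" and i: "i < n" "s i"
  shows "posterior_unlocked n k a b s i = p_plus n k a b (num_minus n s)"
  unfolding p_plus_def
  using posterior_given_count[OF s i(1)] i
  by (intro the_equality[symmetric]) auto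

text \<open>
  Exchanging the sums over sites and over lock sets turns a posterior average into a sum over the
  unlocked sites of each lock set. With \<open>f = 1\<close> this counts the \<open>n - k\<close> unlocked sites, with \<open>f\<close> the
  destruction probability it computes expected values.
\<close>

lemma sum_unlocked_mass:
  "(\<Sum>i<n. unlocked_mass n k a b s i * f i) =
   (\<Sum>L\<in>lock_sets n k. pmf (lock_signal_pmf n k a b) (L, s) * (\<Sum>i\<in>{..<n} - L. f i))"
proof -
  have "(\<Sum>i<n. unlocked_mass n k a b s i * f i) =
      (\<Sum>i<n. \<Sum>L\<in>lock_sets n k.
        if i \<notin> L then pmf (lock_signal_pmf n k a b) (L, s) * f i else 0)"
    unfolding unlocked_mass_def sum_distrib_right
    by (simp add: sum.inter_filter[OF finite_lock_sets])
  also have "\<dots> = (\<Sum>L\<in>lock_sets n k. \<Sum>i<n.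
        if i \<notin> L then pmf (lock_signal_pmf n k a b) (L, s) * f i else 0)"
    by (rule sum.swap)
  also have "\<dots> = (\<Sum>L\<in>lock_sets n k. \<Sum>i\<in>{..<n} - L. pmf (lock_signal_pmf n k a b) (L, s) * f i)"
  proof (rule sum.cong[OF refl])
    fix L :: "nat set"
    have "{..<n} - L = {i \<in> {..<n}. i \<notin> L}" by auto
    then show "(\<Sum>i<n. if i \<notin> L then pmf (lock_signal_pmf n k a b) (L, s) * f i else 0) =
        (\<Sum>i\<in>{..<n} - L. pmf (lock_signal_pmf n k a b) (L, s) * f i)"
      by (simp only: sum.inter_filter finite_lessThan)
  qed
  finally show ?thesis
    by (simp add: sum_distrib_left)
qed

text \<open>
  If all signs agree, all sites have the same posterior, and the posteriors sum to the number \<open>n - k\<close>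
  of unlocked sites.
\<close>

lemma posterior_uniform:
  assumes s: "s \<in> signals n" and N: "num_minus n s = 0 \<or> num_minus n s = n" and i: "i < n"
  shows "posterior_unlocked n k a b s i = (real n - real k) / real n"
proof -
  have const: "s j = s i" if "j < n" for j
  proof (cases "num_minus n s = 0")
    case True
    then show ?thesis using that i by (auto simp: num_minus_def minus_sites_def)
  next
    case False
    then have "minus_sites n s = {..<n}"
      using N by (intro card_subset_eq) (auto simp: num_minus_def minus_sites_def)
    then show ?thesis using that i by (auto simp: minus_sites_def)
  qed
  have "real n * unlocked_mass n k a b s i = (\<Sum>j<n. unlocked_mass n k a b s j * 1)"
    using masses_symmetric(2)[OF s s refl _ i] const by simp
  also have "\<dots> = (\<Sum>L\<in>lock_sets n k. pmf (lock_signal_pmf n k a b) (L, s) * (real n - real k))"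
    unfolding sum_unlocked_mass using k_less
    by (intro sum.cong)
      (auto simp: lock_sets_def card_Diff_subset finite_subset)
  also have "\<dots> = (real n - real k) * signal_mass n k a b s"
    by (simp add: signal_mass_def sum_distrib_left mult.commute)
  finally show ?thesis
    using signal_mass_pos[OF s] i by (simp add: posterior_unlocked_eq[OF s] field_simps)
qed

section \<open>Minus sites are more likely to be unlocked\<close>

text \<open>
  Lock sets containing both or neither of the sites contribute equally to both sides or to none. The
  others are matched by moving the lock from the plus site \<open>j\<close> to the minus site \<open>i\<close>; this replaces the
  factor \<open>ab\<close> of the likelihood by \<open>(1 - a)(1 - b)\<close>, which is at most \<open>ab\<close> because \<open>a + b \<ge> 1\<close>.
\<close>

lemma unlocked_mass_plus_le_minus:
  assumes ab: "1 \<le> a + b" and s: "s \<in> signals n"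
    and i: "i < n" "\<not> s i" and j: "j < n" "s j"
  shows "unlocked_mass n k a b s j \<le> unlocked_mass n k a b s i"
proof -
  let ?w = "\<lambda>L. pmf (lock_signal_pmf n k a b) (L, s)"
  let ?I = "{L. L \<in> lock_sets n k \<and> i \<notin> L}" and ?J = "{L. L \<in> lock_sets n k \<and> j \<notin> L}"
  define sw where "sw = (\<lambda>L. insert i (L - {j}))"
  have ij: "i \<noteq> j" using i j by auto
  have fin: "finite L" if "L \<in> lock_sets n k" for L
    using that by (auto simp: lock_sets_def intro: finite_subset)
  have sw: "sw L \<in> ?J - ?I" and undo: "insert j (sw L - {i}) = L" if "L \<in> ?I - ?J" for L
  proof -
    show "insert j (sw L - {i}) = L"
      using that ij by (auto simp: sw_def)
    have "finite L"
      using that by (intro fin) simp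
    with that have L: "j \<in> L" "i \<notin> L" "card L = k" "finite L"
      unfolding lock_sets_def by blast+
    then have "card (sw L) = Suc (card (L - {j}))"
      unfolding sw_def by (intro card_insert_disjoint) auto
    then have "card (sw L) = k"
      using card_Suc_Diff1[OF L(4,1)] L(3) by (simp only:)
    then show "sw L \<in> ?J - ?I"
      using that ij i by (auto simp: lock_sets_def sw_def)
  qed
  have onto: "\<exists>L. L \<in> ?I - ?J \<and> sw L = L'" if "L' \<in> ?J - ?I" for L'
  proof (intro exI conjI)
    have "finite L'"
      using that by (intro fin) simp
    with that have L': "i \<in> L'" "j \<notin> L'" "card L' = k" "finite L'"
      unfolding lock_sets_def by blast+
    then have "card (insert j (L' - {i})) = Suc (card (L' - {i}))"
      by (intro card_insert_disjoint) auto
    then have "card (insert j (L' - {i})) = k"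
      using card_Suc_Diff1[OF L'(4,1)] L'(3) by (simp only:)
    then show "insert j (L' - {i}) \<in> ?I - ?J"
      using that ij j by (auto simp: lock_sets_def)
    show "sw (insert j (L' - {i})) = L'"
      using that ij by (auto simp: sw_def)
  qed
  have bij: "bij_betw sw (?I - ?J) (?J - ?I)"
  proof (rule bij_betw_imageI)
    show "inj_on sw (?I - ?J)"
      by (rule inj_on_inverseI[where g = "\<lambda>L. insert j (L - {i})"]) (rule undo)
    show "sw ` (?I - ?J) = ?J - ?I"
      using sw onto by blast
  qed
  have le: "?w (sw L) \<le> ?w L" if L: "L \<in> ?I - ?J" for L
  proof -
    let ?R = "{..<n} - {i} - {j}"
    have split: "(\<Prod>l<n. h l) = h i * (h j * (\<Prod>l\<in>?R. h l))" for h :: "nat \<Rightarrow> real"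
      using i j ij by (simp add: prod.remove[of "{..<n}" i] prod.remove[of "{..<n} - {i}" j])
    have rest: "(\<Prod>l\<in>?R. test_lik a b (l \<in> sw L) (s l)) = (\<Prod>l\<in>?R. test_lik a b (l \<in> L) (s l))"
      by (intro prod.cong) (auto simp: sw_def)
    have "(1 - a) * (1 - b) \<le> b * a"
      using ab by (simp add: algebra_simps)
    then have "(1 - a) * ((1 - b) * (\<Prod>l\<in>?R. test_lik a b (l \<in> L) (s l)))
        \<le> b * (a * (\<Prod>l\<in>?R. test_lik a b (l \<in> L) (s l)))"
      unfolding mult.assoc[symmetric]
      by (intro mult_right_mono prod_nonneg) (auto intro: less_imp_le test_lik_pos)
    then have "(\<Prod>l<n. test_lik a b (l \<in> sw L) (s l)) \<le> (\<Prod>l<n. test_lik a b (l \<in> L) (s l))"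
      unfolding split rest using L i j ij by (simp add: sw_def test_lik_def)
    then show ?thesis
      using L sw[OF L] s by (simp add: pmf_lock_signal divide_right_mono)
  qed
  have finIJ: "finite ?I" "finite ?J"
    using finite_lock_sets by auto
  have "sum ?w (?J - ?I) = (\<Sum>L\<in>?I - ?J. ?w (sw L))"
    by (rule sum.reindex_bij_betw[OF bij, symmetric])
  also have "\<dots> \<le> sum ?w (?I - ?J)"
    by (intro sum_mono le)
  finally show ?thesis
    unfolding unlocked_mass_def
    using sum.Int_Diff[OF finIJ(1), of ?w ?J] sum.Int_Diff[OF finIJ(2), of ?w ?I]
    by (simp add: Int_commute)
qed

section \<open>The expected number of destroyed sites\<close>

text \<open>
  By linearity it suffices to consider one unlocked site, which survives if none of its independent
  bombs explodes.
\<close>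

lemma expected_destroyed_allocation:
  assumes p: "0 \<le> p" "p \<le> 1" and L: "L \<subseteq> {..<n}"
  shows "measure_pmf.expectation
      (Pi_pmf (SIGMA i:{..<n} - L. {..<u i}) False (\<lambda>_. bernoulli_pmf p))
      (\<lambda>E. real (card (destroyed n L u E))) = (\<Sum>i\<in>{..<n} - L. destroy_prob p (u i))"
proof -
  let ?B = "SIGMA i:{..<n} - L. {..<u i}"
  let ?M = "Pi_pmf ?B False (\<lambda>_. bernoulli_pmf p)"
  have fin: "finite ?B" by simp
  \<comment> \<open>The event that no bomb placed at site \<open>i\<close> explodes.\<close>
  let ?safe = "\<lambda>i. {E. \<forall>c<u i. \<not> E (i, c)}"
  have safe: "measure_pmf.prob ?M (?safe i) = (1 - p) ^ u i" if i: "i \<in> {..<n} - L" for i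
  proof -
    have "?safe i = Pi ?B (\<lambda>\<beta>. if fst \<beta> = i then {False} else UNIV)"
      using i by (auto simp: Pi_def)
    then have "measure_pmf.prob ?M (?safe i) =
        (\<Prod>\<beta>\<in>?B. measure_pmf.prob (bernoulli_pmf p) (if fst \<beta> = i then {False} else UNIV))"
      by (simp only: measure_Pi_pmf_Pi[OF fin])
    also have "\<dots> = (\<Prod>\<beta>\<in>?B. if fst \<beta> = i then 1 - p else 1)"
      using p by (intro prod.cong) (auto simp: measure_pmf_single)
    also have "\<dots> = (\<Prod>l\<in>{..<n} - L. \<Prod>c<u l. if l = i then 1 - p else 1)"
      by (subst prod.Sigma) (auto simp: case_prod_beta)
    also have "\<dots> = (\<Prod>l\<in>{..<n} - L. if l = i then (1 - p) ^ u l else 1)"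
      by (intro prod.cong) auto
    also have "\<dots> = (1 - p) ^ u i"
      using i by (simp add: prod.delta)
    finally show ?thesis .
  qed
  have "real (card (destroyed n L u E)) = (\<Sum>i\<in>{..<n} - L. indicator (- ?safe i) E)" for E
  proof -
    have "(\<Sum>i\<in>{..<n} - L. indicator (- ?safe i) E) =
        (\<Sum>i\<in>{..<n} - L. if \<exists>c<u i. E (i, c) then 1 else (0::real))"
      by (intro sum.cong) (auto simp: indicator_def)
    also have "\<dots> = real (card (destroyed n L u E))"
      unfolding destroyed_def by (simp add: sum.inter_filter[symmetric])
    finally show ?thesis by simp
  qed
  then have "measure_pmf.expectation ?M (\<lambda>E. real (card (destroyed n L u E))) =
      (\<Sum>i\<in>{..<n} - L. measure_pmf.prob ?M (- ?safe i))"
    by (simp only:, subst Bochner_Integration.integral_sum)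
      (auto intro: measure_pmf.integrable_const_bound[where B = 1])
  also have "\<dots> = (\<Sum>i\<in>{..<n} - L. destroy_prob p (u i))"
  proof (intro sum.cong refl)
    fix i assume "i \<in> {..<n} - L"
    then show "measure_pmf.prob ?M (- ?safe i) = destroy_prob p (u i)"
      using measure_pmf.prob_compl[of "?safe i" ?M] safe[of i]
      by (simp add: Compl_eq_Diff_UNIV destroy_prob_def)
  qed
  finally show ?thesis .
qed

text \<open>
  The tower property, conditioning first on the locks and the signal, and then regrouping by signal.
\<close>

lemma expected_destroyed_eq:
  assumes p: "0 \<le> p" "p \<le> 1"
  shows "expected_destroyed n k a b p \<pi> =
    (\<Sum>s\<in>signals n. signal_mass n k a b s * alloc_value n k a b p s (\<pi> s))"
proof -
  let ?J = "lock_signal_pmf n k a b"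
  let ?M = "\<lambda>L s. Pi_pmf (SIGMA i:{..<n} - L. {..<\<pi> s i}) False (\<lambda>_. bernoulli_pmf p)"
  have finM: "finite (set_pmf (?M L s))" for L s
    by (rule finite_subset[OF set_Pi_pmf_subset']) (auto intro!: finite_PiE_dflt)
  have out: "outcome_pmf n k a b p \<pi> = bind_pmf ?J (\<lambda>(L, s). map_pmf (\<lambda>E. (L, s, E)) (?M L s))"
    by (simp add: outcome_pmf_def map_pmf_def)
  have "expected_destroyed n k a b p \<pi> =
      (\<Sum>(L, s)\<in>lock_sets n k \<times> signals n. pmf ?J (L, s) *
         measure_pmf.expectation (?M L s) (\<lambda>E. real (card (destroyed n L (\<pi> s) E))))"
    unfolding expected_destroyed_def out
    by (subst pmf_expectation_bind[OF _ _ set_pmf_lock_signal])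
      (auto simp: finite_signals finite_lock_sets finM case_prod_beta intro!: sum.cong)
  also have "\<dots> = (\<Sum>L\<in>lock_sets n k. \<Sum>s\<in>signals n. pmf ?J (L, s) *
      (\<Sum>i\<in>{..<n} - L. destroy_prob p (\<pi> s i)))"
    unfolding sum.cartesian_product[symmetric]
    using p by (intro sum.cong) (auto simp: expected_destroyed_allocation lock_sets_def)
  also have "\<dots> = (\<Sum>s\<in>signals n. \<Sum>L\<in>lock_sets n k. pmf ?J (L, s) *
      (\<Sum>i\<in>{..<n} - L. destroy_prob p (\<pi> s i)))"
    by (rule sum.swap)
  also have "\<dots> = (\<Sum>s\<in>signals n. signal_mass n k a b s * alloc_value n k a b p s (\<pi> s))"
  proof (rule sum.cong[OF refl])
    fix s assume s: "s \<in> signals n"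
    show "(\<Sum>L\<in>lock_sets n k. pmf ?J (L, s) * (\<Sum>i\<in>{..<n} - L. destroy_prob p (\<pi> s i)))
        = signal_mass n k a b s * alloc_value n k a b p s (\<pi> s)"
      unfolding sum_unlocked_mass[symmetric] alloc_value_def
      using signal_mass_pos[OF s] by (simp add: posterior_unlocked_eq[OF s] sum_distrib_left)
  qed
  finally show ?thesis .
qed

section \<open>Optimal allocations and their values\<close>

lemma optimal_allocation_exchange:
  assumes p: "0 \<le> p" "p \<le> 1" and s: "s \<in> signals n" and u: "u \<in> allocations n m"
    and exch: "\<And>i j. i < n \<Longrightarrow> j < n \<Longrightarrow> 0 < u i \<Longrightarrow>
      posterior_unlocked n k a b s j * (1 - p) ^ u j
        \<le> posterior_unlocked n k a b s i * (1 - p) ^ (u i - 1)"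
  shows "optimal_allocation n k a b p m s u"
proof -
  have "alloc_value n k a b p s v \<le> alloc_value n k a b p s u" if "v \<in> allocations n m" for v
    unfolding alloc_value_def
    using p s u that exch
    by (intro exchange_condition_optimal)
      (auto simp: allocations_def intro: less_imp_le posterior_unlocked_pos)
  then show ?thesis
    using u by (simp add: optimal_allocation_def signal_value_eqI)
qed

lemma uap_optimal:
  assumes p: "0 \<le> p" "p \<le> 1" and s: "s \<in> signals n"
    and N: "num_minus n s = 0 \<or> num_minus n s = n" and u: "uap n m u"
  shows "optimal_allocation n k a b p m s u"
proof (rule optimal_allocation_exchange[OF p s])
  show "u \<in> allocations n m"
    using u by (simp add: uap_def)
  fix i j assume i: "i < n" and j: "j < n"
  have "u i \<le> Suc (u j)"
    using uap_balanced[OF u] i j by (auto simp: balanced_def)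
  then have "u i - 1 \<le> u j"
    by simp
  then show "posterior_unlocked n k a b s j * (1 - p) ^ u j
      \<le> posterior_unlocked n k a b s i * (1 - p) ^ (u i - 1)"
    using p k_less by (simp add: posterior_uniform[OF s N] i j
        mult_left_mono power_decreasing divide_right_mono)
qed

lemma signal_value_uniform:
  assumes p: "0 \<le> p" "p \<le> 1" and s: "s \<in> signals n"
    and N: "num_minus n s = 0 \<or> num_minus n s = n" and m: "m = n * i + e" "e < n"
  shows "signal_value n k a b p s m = (real n - real k) / real n *
    (real e * destroy_prob p (i + 1) + (real n - real e) * destroy_prob p i)"
proof -
  have n: "0 < n" using k_less by simp
  then have I: "finite {..<n}" "{..<n} \<noteq> {}" by auto
  obtain u where u: "uap n m u"
    using uap_exists[OF n] by blast
  note bal = uap_balanced[OF u]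
  let ?c = "complete_layers {..<n} u" and ?e = "extra_bombs {..<n} u"
  have "?c * n + ?e = i * n + e" "?e < n"
    using balanced_sum[OF I bal] balanced_extra_less[OF I bal] u m
    by (auto simp: uap_def allocations_def mult.commute)
  then have ie: "?c = i" "?e = e"
    using quotient_remainder_unique[of ?c n ?e i e] m(2) by simp_all
  have "signal_value n k a b p s m = alloc_value n k a b p s u"
    using uap_optimal[OF p s N u] by (simp add: optimal_allocation_def)
  also have "\<dots> = (real n - real k) / real n * (\<Sum>l<n. destroy_prob p (u l))"
    unfolding alloc_value_def by (simp add: posterior_uniform[OF s N] sum_distrib_left)
  also have "(\<Sum>l<n. destroy_prob p (u l)) =
      real e * destroy_prob p (i + 1) + (real n - real e) * destroy_prob p i"
    using balanced_sum_apply[OF I bal, of "destroy_prob p"] by (simp add: ie)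
  finally show ?thesis .
qed

lemma ex_signal:
  assumes "x \<le> n"
  shows "\<exists>s\<in>signals n. num_minus n s = x"
  using ex_signal_at[of 0 True x] ex_signal_at[of 0 False x] assms k_less by (cases "x < n") auto

lemma ratio_bounds:
  assumes ab: "1 \<le> a + b" and x: "0 < x" "x < n"
  shows p_plus_pos: "0 < p_plus n k a b x"
    and p_minus_eq: "p_minus n k a b x = ratio n k a b x * p_plus n k a b x"
    and ratio_ge_1: "1 \<le> ratio n k a b x"
proof -
  obtain s where s: "s \<in> signals n" "num_minus n s = x"
    using ex_signal[of x] x by auto
  have "minus_sites n s \<noteq> {}" "plus_sites n s \<noteq> {}"
    using s x sites_partition(5,6)[of n s] by auto
  then obtain i j where i: "i < n" "\<not> s i" and j: "j < n" "s j"
    by (auto simp: minus_sites_def plus_sites_def)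
  have pp: "p_plus n k a b x = posterior_unlocked n k a b s j"
    and pm: "p_minus n k a b x = posterior_unlocked n k a b s i"
    using posterior_plus[OF s(1) j] posterior_minus[OF s(1) i] s(2) by simp_all
  show pos: "0 < p_plus n k a b x"
    unfolding pp by (rule posterior_unlocked_pos[OF s(1) j(1)])
  then show "p_minus n k a b x = ratio n k a b x * p_plus n k a b x"
    by (simp add: ratio_def)
  have "p_plus n k a b x \<le> p_minus n k a b x"
    unfolding pp pm posterior_unlocked_eq[OF s(1)]
    using unlocked_mass_plus_le_minus[OF ab s(1) i j] signal_mass_pos[OF s(1)]
    by (simp add: divide_right_mono)
  then show "1 \<le> ratio n k a b x"
    using pos by (simp add: ratio_def)
qed

text \<open>
  The ratio is finite and \<open>1 - p < 1\<close>, so the geometric decay wins; the index is shifted by one to make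
  it positive.
\<close>

lemma uap_level_exists:
  assumes ab: "1 \<le> a + b" and x: "0 < x" "x < n" and p: "0 < p" "p \<le> 1"
  shows "\<exists>i\<ge>1. ratio n k a b x * (1 - p) ^ i < 1"
proof -
  have r: "1 \<le> ratio n k a b x" by (rule ratio_ge_1[OF ab x])
  obtain i where i: "(1 - p) ^ i < 1 / ratio n k a b x"
    using real_arch_pow_inv[of "1 / ratio n k a b x" "1 - p"] r p by auto
  have "(1 - p) ^ Suc i \<le> (1 - p) ^ i"
    using p by (intro power_decreasing) auto
  then have "(1 - p) ^ Suc i < 1 / ratio n k a b x"
    using i by linarith
  then show ?thesis
    using r by (intro exI[of _ "Suc i"]) (simp add: field_simps)
qed

text \<open>
  The last inequality is minimality of the level if the level exceeds one, and \<open>r \<ge> 1\<close> otherwise.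
\<close>

lemma uap_level_spec:
  assumes ab: "1 \<le> a + b" and x: "0 < x" "x < n" and p: "0 < p" "p \<le> 1"
  defines "d \<equiv> uap_level n k a b p x"
  shows "1 \<le> d" and "ratio n k a b x * (1 - p) ^ d < 1"
    and "1 \<le> ratio n k a b x * (1 - p) ^ (d - 1)"
proof -
  have "\<exists>i. 1 \<le> i \<and> ratio n k a b x * (1 - p) ^ i < 1"
    using uap_level_exists[OF ab x p] by blast
  then have "1 \<le> d \<and> ratio n k a b x * (1 - p) ^ d < 1"
    unfolding d_def uap_level_def by (rule LeastI_ex)
  then show d: "1 \<le> d" and "ratio n k a b x * (1 - p) ^ d < 1"
    by auto
  show "1 \<le> ratio n k a b x * (1 - p) ^ (d - 1)"
  proof (cases "d = 1")
    case True
    then show ?thesis using ratio_ge_1[OF ab x] by simp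
  next
    case False
    then have d1: "1 \<le> d - 1" "d - 1 < d" using d by auto
    from d1(2) have "\<not> (1 \<le> d - 1 \<and> ratio n k a b x * (1 - p) ^ (d - 1) < 1)"
      unfolding d_def uap_level_def by (rule not_less_Least)
    then show ?thesis
      using d1(1) by linarith
  qed
qed

lemma d_uap_optimal:
  assumes ab: "1 \<le> a + b" and p: "0 < p" "p \<le> 1" and s: "s \<in> signals n"
    and x: "0 < num_minus n s" "num_minus n s < n"
    and u: "d_uap n m (uap_level n k a b p (num_minus n s)) s u"
  shows "optimal_allocation n k a b p m s u"
proof (rule optimal_allocation_exchange)
  show "u \<in> allocations n m"
    using u by (simp add: d_uap_def)
  let ?x = "num_minus n s"
  let ?d = "uap_level n k a b p ?x"
  note lev = uap_level_spec[OF ab x p]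
  note pos = p_plus_pos[OF ab x] and r = ratio_ge_1[OF ab x]
  fix i j assume i: "i < n" and j: "j < n" and ui: "0 < u i"
  show "posterior_unlocked n k a b s j * (1 - p) ^ u j
      \<le> posterior_unlocked n k a b s i * (1 - p) ^ (u i - 1)"
  proof (rule staggered_exchange[OF d_uap_staggered[OF u]])
    show "p_plus n k a b ?x \<le> (ratio n k a b ?x * p_plus n k a b ?x) * (1 - p) ^ (?d - 1)"
      using mult_right_mono[OF lev(3), of "p_plus n k a b ?x"] pos by (simp add: mult_ac)
    show "(ratio n k a b ?x * p_plus n k a b ?x) * (1 - p) ^ ?d \<le> p_plus n k a b ?x"
      using mult_right_mono[OF less_imp_le[OF lev(2)], of "p_plus n k a b ?x"] pos
      by (simp add: mult_ac)
  qed (use p pos r lev(1) i j ui s in \<open>auto simp: posterior_minus posterior_plus minus_sites_def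
        plus_sites_def p_minus_eq[OF ab x]\<close>)
qed (use p s in auto)

text \<open>
  The value depends on the signal and on the allocation only through the tuple; with uniqueness of the
  tuple, this makes it a function of \<open>x\<close> and \<open>m\<close>.
\<close>

lemma d_uap_tuple_properties:
  assumes ab: "1 \<le> a + b" and p: "0 < p" "p \<le> 1" and x: "0 < x" "x < n"
    and s: "s \<in> signals n" "num_minus n s = x"
    and u: "d_uap n m (uap_level n k a b p x) s u"
    and \<tau>: "i = complete_layers (minus_sites n s) u" "e = extra_bombs (minus_sites n s) u"
      "j = complete_layers (plus_sites n s) u" "e' = extra_bombs (plus_sites n s) u"
  shows "staggered_tuple (uap_level n k a b p x) x (n - x) (i, e, j, e')"
    and "m = (i * x + e) + (j * (n - x) + e')"
    and "signal_value n k a b p s m = p_plus n k a b x *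
      (ratio n k a b x * (real e * destroy_prob p (i + 1) + (real x - real e) * destroy_prob p i)
        + real e' * destroy_prob p (j + 1) + (real n - real x - real e') * destroy_prob p j)"
proof -
  let ?M = "minus_sites n s" and ?P = "plus_sites n s"
  have card: "card ?M = x" "card ?P = n - x"
    using s sites_partition(5,6)[of n s] by auto
  then have M: "finite ?M" "?M \<noteq> {}" and P: "finite ?P" "?P \<noteq> {}"
    using x sites_partition(3,4) by auto
  note stag = d_uap_staggered[OF u]
  then have bal: "balanced ?M u" "balanced ?P u"
    by (auto simp: staggered_def)
  show "staggered_tuple (uap_level n k a b p x) x (n - x) (i, e, j, e')"
    using staggered_tupleI[OF stag M P] by (simp add: card \<tau>)
  have split: "sum f {..<n} = sum f ?M + sum f ?P" for f :: "nat \<Rightarrow> 'a::comm_monoid_add"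
    using sum.union_disjoint[OF M(1) P(1) sites_partition(2), of f] by (simp add: sites_partition(1))
  have "m = sum u {..<n}"
    using u by (simp add: d_uap_def allocations_def)
  then show "m = (i * x + e) + (j * (n - x) + e')"
    using split[of u] balanced_sum[OF M bal(1)] balanced_sum[OF P bal(2)]
    by (simp add: card \<tau>)
  have "signal_value n k a b p s m = alloc_value n k a b p s u"
    using d_uap_optimal[OF ab p s(1), of m u] s(2) x u by (simp add: optimal_allocation_def)
  also have "\<dots> = (\<Sum>l\<in>?M. p_minus n k a b x * destroy_prob p (u l))
      + (\<Sum>l\<in>?P. p_plus n k a b x * destroy_prob p (u l))"
    unfolding alloc_value_def split using s
    by (intro arg_cong2[of _ _ _ _ "(+)"] sum.cong)
      (auto simp: minus_sites_def plus_sites_def posterior_minus posterior_plus)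
  also have "\<dots> = p_plus n k a b x * (ratio n k a b x * (\<Sum>l\<in>?M. destroy_prob p (u l))
      + (\<Sum>l\<in>?P. destroy_prob p (u l)))"
    unfolding sum_distrib_left[symmetric] p_minus_eq[OF ab x] by (simp add: algebra_simps)
  also have "\<dots> = p_plus n k a b x *
      (ratio n k a b x * (real e * destroy_prob p (i + 1) + (real x - real e) * destroy_prob p i)
        + real e' * destroy_prob p (j + 1) + (real n - real x - real e') * destroy_prob p j)"
    using x by (simp add: balanced_sum_apply[OF M bal(1), of "destroy_prob p"]
        balanced_sum_apply[OF P bal(2), of "destroy_prob p"] card \<tau> of_nat_diff add.assoc)
  finally show "signal_value n k a b p s m = p_plus n k a b x *
      (ratio n k a b x * (real e * destroy_prob p (i + 1) + (real x - real e) * destroy_prob p i)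
        + real e' * destroy_prob p (j + 1) + (real n - real x - real e') * destroy_prob p j)" .
qed

lemma d_uap_tuple_staggered:
  assumes ab: "1 \<le> a + b" and p: "0 < p" "p \<le> 1" and x: "0 < x" "x < n"
    and \<tau>: "d_uap_tuple n m (uap_level n k a b p x) x (i, e, j, e')"
  shows "staggered_tuple (uap_level n k a b p x) x (n - x) (i, e, j, e')"
    and "m = (i * x + e) + (j * (n - x) + e')"
proof -
  obtain s u where su: "s \<in> signals n" "num_minus n s = x" "d_uap n m (uap_level n k a b p x) s u"
    and eq: "i = complete_layers (minus_sites n s) u" "e = extra_bombs (minus_sites n s) u"
      "j = complete_layers (plus_sites n s) u" "e' = extra_bombs (plus_sites n s) u"
    using \<tau> by (auto simp: d_uap_tuple_def)
  show "staggered_tuple (uap_level n k a b p x) x (n - x) (i, e, j, e')"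
    and "m = (i * x + e) + (j * (n - x) + e')"
    by (rule d_uap_tuple_properties(1,2)[OF ab p x su eq])+
qed

lemma ex1_d_uap_tuple:
  assumes ab: "1 \<le> a + b" and p: "0 < p" "p \<le> 1" and x: "0 < x" "x < n"
  shows "\<exists>!\<tau>. d_uap_tuple n m (uap_level n k a b p x) x \<tau>"
proof -
  obtain s where s: "s \<in> signals n" "num_minus n s = x"
    using ex_signal[of x] x by auto
  then obtain u where u: "d_uap n m (uap_level n k a b p x) s u"
    using d_uap_exists[of n s] x by blast
  have "\<tau> = \<tau>'"
    if t: "d_uap_tuple n m (uap_level n k a b p x) x \<tau>"
      "d_uap_tuple n m (uap_level n k a b p x) x \<tau>'" for \<tau> \<tau>'
  proof -
    obtain i1 e1 j1 e1' i2 e2 j2 e2' where eq: "\<tau> = (i1, e1, j1, e1')" "\<tau>' = (i2, e2, j2, e2')"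
      by (cases \<tau>, cases \<tau>')
    note facts = d_uap_tuple_staggered[OF ab p x]
    show ?thesis
      unfolding eq
    proof (rule staggered_tuple_unique)
      show "staggered_tuple (uap_level n k a b p x) x (n - x) (i1, e1, j1, e1')"
        and "staggered_tuple (uap_level n k a b p x) x (n - x) (i2, e2, j2, e2')"
        using facts(1) t unfolding eq by blast+
      show "(i1 * x + e1) + (j1 * (n - x) + e1') = (i2 * x + e2) + (j2 * (n - x) + e2')"
        using facts(2)[OF t(1)[unfolded eq]] facts(2)[OF t(2)[unfolded eq]] by (rule trans[OF sym])
    qed
  qed
  moreover have "d_uap_tuple n m (uap_level n k a b p x) x
      (complete_layers (minus_sites n s) u, extra_bombs (minus_sites n s) u,
       complete_layers (plus_sites n s) u, extra_bombs (plus_sites n s) u)"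
    using s u unfolding d_uap_tuple_def by blast
  ultimately show ?thesis by blast
qed

lemma minus_value_eqI:
  assumes "x \<le> n"
    and "\<And>s. s \<in> signals n \<Longrightarrow> num_minus n s = x \<Longrightarrow> signal_value n k a b p s m = c"
  shows "minus_value n k a b p x m = c"
  unfolding minus_value_def using ex_signal[OF assms(1)] assms(2)
  by (intro the_equality) auto

lemma minus_value_uniform:
  assumes p: "0 \<le> p" "p \<le> 1" and x: "x = 0 \<or> x = n" and m: "m = n * i + e" "e < n"
  shows "minus_value n k a b p x m = (real n - real k) / real n *
    (real e * destroy_prob p (i + 1) + (real n - real e) * destroy_prob p i)"
  using x by (intro minus_value_eqI signal_value_uniform[OF p _ _ m]) auto

lemma minus_value_mixed:
  assumes ab: "1 \<le> a + b" and p: "0 < p" "p \<le> 1" and x: "0 < x" "x < n"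
    and \<tau>: "d_uap_tuple n m (uap_level n k a b p x) x (i, e, j, e')"
  shows "minus_value n k a b p x m = p_plus n k a b x *
      (ratio n k a b x * (real e * destroy_prob p (i + 1) + (real x - real e) * destroy_prob p i)
        + real e' * destroy_prob p (j + 1) + (real n - real x - real e') * destroy_prob p j)"
proof (rule minus_value_eqI)
  fix s assume s: "s \<in> signals n" "num_minus n s = x"
  then obtain u where u: "d_uap n m (uap_level n k a b p x) s u"
    using d_uap_exists[of n s] x by blast
  then have "d_uap_tuple n m (uap_level n k a b p x) x
      (complete_layers (minus_sites n s) u, extra_bombs (minus_sites n s) u,
       complete_layers (plus_sites n s) u, extra_bombs (plus_sites n s) u)"
    using s unfolding d_uap_tuple_def by blast
  then have "(i, e, j, e') =
      (complete_layers (minus_sites n s) u, extra_bombs (minus_sites n s) u,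
       complete_layers (plus_sites n s) u, extra_bombs (plus_sites n s) u)"
    using ex1_d_uap_tuple[OF ab p x] \<tau> by blast
  then show "signal_value n k a b p s m = p_plus n k a b x *
      (ratio n k a b x * (real e * destroy_prob p (i + 1) + (real x - real e) * destroy_prob p i)
        + real e' * destroy_prob p (j + 1) + (real n - real x - real e') * destroy_prob p j)"
    using d_uap_tuple_properties(3)[OF ab p x s u] by simp
qed (use x in simp)

text \<open>
  The value of a signal is a function of its number of minuses, since both closed forms are.
\<close>

lemma minus_value_signal:
  assumes ab: "1 \<le> a + b" and p: "0 < p" "p \<le> 1" and s: "s \<in> signals n"
  shows "minus_value n k a b p (num_minus n s) m = signal_value n k a b p s m"
proof (cases "num_minus n s = 0 \<or> num_minus n s = n")
  case True
  have m: "m = n * (m div n) + m mod n" "m mod n < n"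
    using k_less by auto
  show ?thesis
    using minus_value_uniform[OF _ p(2) True m] signal_value_uniform[OF _ p(2) s True m] p(1) by simp
next
  case False
  then have x: "0 < num_minus n s" "num_minus n s < n"
    using num_minus_le[of n s] by auto
  then obtain u where u: "d_uap n m (uap_level n k a b p (num_minus n s)) s u"
    using d_uap_exists[of n s] by blast
  then have "d_uap_tuple n m (uap_level n k a b p (num_minus n s)) (num_minus n s)
      (complete_layers (minus_sites n s) u, extra_bombs (minus_sites n s) u,
       complete_layers (plus_sites n s) u, extra_bombs (plus_sites n s) u)"
    using s unfolding d_uap_tuple_def by blast
  then show ?thesis
    using minus_value_mixed[OF ab p x] d_uap_tuple_properties(3)[OF ab p x s refl u] by simp
qed

section \<open>The value of the whole game\<close>

text \<open>
  A strategy chooses its allocation for every signal independently, so combining one optimal allocation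
  per signal attains the upper bound.
\<close>

lemma total_value_signals:
  assumes p: "0 \<le> p" "p \<le> 1"
  shows "total_value n k a b p m = (\<Sum>s\<in>signals n. signal_mass n k a b s * signal_value n k a b p s m)"
  unfolding total_value_def
proof (rule Max_eqI)
  \<comment> \<open>Some allocation exists, so the supremum over the finite set of allocations is attained.\<close>
  have "(\<lambda>l. if l = 0 then m else 0) \<in> allocations n m"
    using k_less by (auto simp: allocations_def sum.delta)
  then have "signal_value n k a b p s m \<in> alloc_value n k a b p s ` allocations n m" for s
    unfolding signal_value_def using finite_allocations[of n m]
    by (subst cSup_eq_Max) (auto intro!: Max_in)
  then have "\<exists>u. u \<in> allocations n m \<and> alloc_value n k a b p s u = signal_value n k a b p s m" for s
    by (metis imageE)
  then obtain best where best: "\<And>s. best s \<in> allocations n m"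
    "\<And>s. alloc_value n k a b p s (best s) = signal_value n k a b p s m"
    by metis
  have "(\<Sum>s\<in>signals n. signal_mass n k a b s * signal_value n k a b p s m) =
      expected_destroyed n k a b p (restrict best (signals n))"
    by (simp add: expected_destroyed_eq[OF p] best(2))
  moreover have "restrict best (signals n) \<in> strategies n m"
    using best(1) by (simp add: strategies_def)
  ultimately show "(\<Sum>s\<in>signals n. signal_mass n k a b s * signal_value n k a b p s m)
      \<in> expected_destroyed n k a b p ` strategies n m"
    by blast
  show "finite (expected_destroyed n k a b p ` strategies n m)"
    unfolding strategies_def by (intro finite_imageI finite_PiE finite_signals finite_allocations)
next
  fix y assume "y \<in> expected_destroyed n k a b p ` strategies n m"
  then obtain \<pi> where \<pi>: "\<pi> \<in> strategies n m" and y: "y = expected_destroyed n k a b p \<pi>"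
    by blast
  show "y \<le> (\<Sum>s\<in>signals n. signal_mass n k a b s * signal_value n k a b p s m)"
    unfolding y expected_destroyed_eq[OF p]
  proof (intro sum_mono mult_left_mono)
    fix s assume s: "s \<in> signals n"
    show "alloc_value n k a b p s (\<pi> s) \<le> signal_value n k a b p s m"
      using \<pi> s by (intro alloc_value_le_signal_value) (auto simp: strategies_def)
    show "0 \<le> signal_mass n k a b s"
      using signal_mass_pos[OF s] by simp
  qed
qed

lemma total_value_eq:
  assumes ab: "1 \<le> a + b" and p: "0 < p" "p \<le> 1"
  shows "total_value n k a b p m =
    (\<Sum>x=0..n. prob_num_minus n k a b x * minus_value n k a b p x m)"
proof -
  have "total_value n k a b p m =
      (\<Sum>s\<in>signals n. signal_mass n k a b s * minus_value n k a b p (num_minus n s) m)"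
    using p by (simp add: total_value_signals minus_value_signal[OF ab p])
  also have "\<dots> = (\<Sum>x=0..n. \<Sum>s | s \<in> signals n \<and> num_minus n s = x.
      signal_mass n k a b s * minus_value n k a b p (num_minus n s) m)"
    using num_minus_le by (intro sum.group[symmetric]) (auto simp: finite_signals)
  also have "\<dots> = (\<Sum>x=0..n. prob_num_minus n k a b x * minus_value n k a b p x m)"
    unfolding prob_num_minus_def using prob_signals[of "\<lambda>s. num_minus n s = x" for x]
    by (auto simp: sum_distrib_right intro!: sum.cong)
  finally show ?thesis .
qed

end

theorem theorem1:
  fixes n k m :: nat and a b p :: real
  assumes "1 \<le> k" and "k < n" and "1 \<le> m"
    and "0 < a" and "a < 1" and "0 < b" and "b < 1" and "a + b > 1"
    and "0 < p" and "p \<le> 1"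
  shows
    "(\<forall>s\<in>signals n. num_minus n s = 0 \<or> num_minus n s = n \<longrightarrow>
        (\<exists>u. uap n m u) \<and> (\<forall>u. uap n m u \<longrightarrow> optimal_allocation n k a b p m s u))
     \<and> (\<forall>i e. m = n * i + e \<and> e < n \<longrightarrow>
        minus_value n k a b p 0 m = minus_value n k a b p n m \<and>
        minus_value n k a b p n m =
          (real n - real k) / real n *
            (real e * destroy_prob p (i + 1) + (real n - real e) * destroy_prob p i))
     \<and> (\<forall>s\<in>signals n. 0 < num_minus n s \<and> num_minus n s < n \<longrightarrow>
        (\<exists>i\<ge>1. ratio n k a b (num_minus n s) * (1 - p) ^ i < 1) \<and>
        (\<exists>u. d_uap n m (uap_level n k a b p (num_minus n s)) s u) \<and>
        (\<forall>u. d_uap n m (uap_level n k a b p (num_minus n s)) s u \<longrightarrow>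
             optimal_allocation n k a b p m s u))
     \<and> (\<forall>x. 0 < x \<and> x < n \<longrightarrow>
        (\<exists>!\<tau>. d_uap_tuple n m (uap_level n k a b p x) x \<tau>) \<and>
        (\<forall>i e j e'. d_uap_tuple n m (uap_level n k a b p x) x (i, e, j, e') \<longrightarrow>
           m = (i * x + e) + (j * (n - x) + e') \<and> e < x \<and> e' < n - x \<and>
           minus_value n k a b p x m =
             p_plus n k a b x *
               (ratio n k a b x *
                  (real e * destroy_prob p (i + 1) + (real x - real e) * destroy_prob p i)
                + real e' * destroy_prob p (j + 1)
                + (real n - real x - real e') * destroy_prob p j)))
     \<and> total_value n k a b p m =
         (\<Sum>x=0..n. prob_num_minus n k a b x * minus_value n k a b p x m)"
proof -
  interpret lock_test_model n k a b
    using assms by unfold_locales auto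
  have ab: "1 \<le> a + b" and p: "0 < p" "0 \<le> p" "p \<le> 1"
    using assms by auto
  show ?thesis
  proof (intro conjI ballI allI impI)
    show "\<exists>u. uap n m u"
      using uap_exists[of n m] \<open>k < n\<close> by simp
  next
    fix s u
    assume "s \<in> signals n" "num_minus n s = 0 \<or> num_minus n s = n" "uap n m u"
    then show "optimal_allocation n k a b p m s u"
      by (rule uap_optimal[OF p(2,3)])
  next
    fix i e
    assume "m = n * i + e \<and> e < n"
    then show "minus_value n k a b p 0 m = minus_value n k a b p n m"
      and "minus_value n k a b p n m = (real n - real k) / real n *
        (real e * destroy_prob p (i + 1) + (real n - real e) * destroy_prob p i)"
      using minus_value_uniform[OF p(2,3)] by simp_all
  next
    fix s
    assume s: "s \<in> signals n" and "0 < num_minus n s \<and> num_minus n s < n"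
    then have x: "0 < num_minus n s" "num_minus n s < n"
      by auto
    show "\<exists>i\<ge>1. ratio n k a b (num_minus n s) * (1 - p) ^ i < 1"
      by (rule uap_level_exists[OF ab x p(1,3)])
    show "\<exists>u. d_uap n m (uap_level n k a b p (num_minus n s)) s u"
      by (rule d_uap_exists[OF x])
    show "optimal_allocation n k a b p m s u"
      if "d_uap n m (uap_level n k a b p (num_minus n s)) s u" for u
      by (rule d_uap_optimal[OF ab p(1,3) s x that])
  next
    fix x
    assume "0 < x \<and> x < n"
    then have x: "0 < x" "x < n"
      by auto
    show "\<exists>!\<tau>. d_uap_tuple n m (uap_level n k a b p x) x \<tau>"
      by (rule ex1_d_uap_tuple[OF ab p(1,3) x])
    fix i e j e'
    assume \<tau>: "d_uap_tuple n m (uap_level n k a b p x) x (i, e, j, e')"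
    show "m = (i * x + e) + (j * (n - x) + e')" "e < x" "e' < n - x"
      using d_uap_tuple_staggered[OF ab p(1,3) x \<tau>] by (auto simp: staggered_tuple_def)
    show "minus_value n k a b p x m =
             p_plus n k a b x *
               (ratio n k a b x *
                  (real e * destroy_prob p (i + 1) + (real x - real e) * destroy_prob p i)
                + real e' * destroy_prob p (j + 1)
                + (real n - real x - real e') * destroy_prob p j)"
      by (rule minus_value_mixed[OF ab p(1,3) x \<tau>])
  next
    show "total_value n k a b p m =
        (\<Sum>x=0..n. prob_num_minus n k a b x * minus_value n k a b p x m)"
      by (rule total_value_eq[OF ab p(1,3)])
  qed
qed

end
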